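(* Let $U,V$ be nonlocal vertex algebras, $R(x)$ a twisting operator for $(U,V)$, and $U\otimes_RV$ the twisted tensor product. Then the $\mathcal D$-operator of $U\otimes_RV$ is $\mathcal D\otimes1+1\otimes\mathcal D$ (where the two $\mathcal D$'s are those of $U$ and $V$). Moreover, for $u\in U$, $v\in V$ (identified with $u\otimes\mathbf 1$ and $\mathbf 1\otimes v$), $$Y_R(u,x)v\in(U\otimes V)[[x]],$$ and, writing $R(x)(v\otimes u)=\sum_{i=1}^r u_i\otimes v_i\otimes f_i(x)$ with $u_i\in U$, $v_i\in V$, $f_i\in\mathbb C((x))$, $$Y_R(v,x)u=e^{x(\mathcal D\otimes1+1\otimes\mathcal D)}\sum_{i=1}^r f_i(-x)\,Y_R(u_i,-x)v_i .$$
   Context: All vector spaces are over $\mathbb{C}$. A nonlocal vertex algebra is a vector space $V$ with a linear map $Y(\cdot,x):V\to \mathrm{Hom}(V,V((x)))$, $v\mapsto Y(v,x)=\sum_{n\in\mathbb Z}v_nx^{-n-1}$, and a vector $\mathbf 1\in V$ such that for all $v$: $Y(\mathbf 1,x)v=v$, $Y(v,x)\mathbf 1\in V[[x]]$, $\lim_{x\to0}Y(v,x)\mathbf 1=v$; and for all $u,v,w$ there is $k\ge0$ with $(x_0+x_2)^kY(u,x_0+x_2)Y(v,x_2)w=(x_0+x_2)^kY(Y(u,x_0)v,x_2)w$. Write $Y(x)(u\otimes v)=Y(u,x)v$. The $\mathcal D$-operator is $\mathcal Dv=v_{-2}\mathbf 1$. Conventions: $f(x_1\pm x_2)$ for $f\in\mathbb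 C((x))$ is expanded in nonnegative powers of the second variable; $T^{ij}$ denotes a map $T$ acting on the $i$-th and $j$-th tensor factors; maps are extended linearly over scalar series. Twisting operator for $(U,V)$: a linear map $R(x):V\otimes U\to U\otimes V\otimes\mathbb C((x))$ such that $R(x)(v\otimes\mathbf 1)=\mathbf 1\otimes v$, $R(x)(\mathbf 1\otimes u)=u\otimes\mathbf 1$, $R(x_1)(1\otimes Y(x_2))=(Y(x_2)\otimes1)R^{23}(x_1)R^{12}(x_1+x_2)$ on $V\otimes U\otimes U$, and $R(x_1)(Y(x_2)\otimes 1)=(1\otimes Y(x_2))R^{12}(x_1-x_2)R^{23}(x_1)$ on $V\otimes V\otimes U$. Twisted tensor product $U\otimes_RV$: the nonlocal vertex algebra on $U\otimes V$ with vacuum $\mathbf 1\otimes\mathbf 1$ and $Y_R(u\otimes v,x)(u'\otimes v')=\sum_i f_i(-x)Y(u,x)u'_i\otimes Y(v_i,x)v'$ where $R(x)(v\otimes u')=\sum_i u'_i\otimes v_i\otimes f_i(x)$ (i.e. $Y_R(x)=(Y(x)\otimes Y(x))R^{23}(-x)$). Elements $u\in U$, $v\in V$ are identified with $u\otimes\mathbf 1$, $\mathbf 1\otimes v$, which embeds $U$ and $V$ as subalgebras. *)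

theory Defs
  imports Complex_Main "HOL-Library.Function_Algebras"
begin

section \<open>Complex vector spaces\<close>

class cvec = ab_group_add +
  fixes scaleC :: "complex \<Rightarrow> 'a \<Rightarrow> 'a" (infixr "*\<^sub>C" 75)
  assumes scaleC_add_right: "c *\<^sub>C (x + y) = c *\<^sub>C x + c *\<^sub>C y"
    and scaleC_add_left: "(c + d) *\<^sub>C x = c *\<^sub>C x + d *\<^sub>C x"
    and scaleC_scaleC: "c *\<^sub>C (d *\<^sub>C x) = (c * d) *\<^sub>C x"
    and scaleC_one: "1 *\<^sub>C x = x"

instantiation complex :: cvec
begin
definition scaleC_complex :: "complex \<Rightarrow> complex \<Rightarrow> complex" where
  "scaleC_complex c z = c * z"
instance by standard (auto simp: scaleC_complex_def algebra_simps)
end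

instantiation "fun" :: (type, cvec) cvec
begin
definition scaleC_fun :: "complex \<Rightarrow> ('a \<Rightarrow> 'b) \<Rightarrow> 'a \<Rightarrow> 'b" where
  "scaleC_fun c f = (\<lambda>x. c *\<^sub>C f x)"
instance by standard (auto simp: scaleC_fun_def scaleC_add_right scaleC_add_left scaleC_scaleC scaleC_one)
end

definition clinear :: "('a::cvec \<Rightarrow> 'b::cvec) \<Rightarrow> bool" where
  "clinear f \<longleftrightarrow> (\<forall>x y. f (x + y) = f x + f y) \<and> (\<forall>c x. f (c *\<^sub>C x) = c *\<^sub>C f x)"

definition cbilinear :: "('a::cvec \<Rightarrow> 'b::cvec \<Rightarrow> 'c::cvec) \<Rightarrow> bool" where
  "cbilinear f \<longleftrightarrow> (\<forall>y. clinear (\<lambda>x. f x y)) \<and> (\<forall>x. clinear (f x))"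

inductive_set cspan :: "'a::cvec set \<Rightarrow> 'a set" for S where
  cspan_zero: "0 \<in> cspan S"
| cspan_base: "x \<in> S \<Longrightarrow> x \<in> cspan S"
| cspan_add: "x \<in> cspan S \<Longrightarrow> y \<in> cspan S \<Longrightarrow> x + y \<in> cspan S"
| cspan_scale: "x \<in> cspan S \<Longrightarrow> c *\<^sub>C x \<in> cspan S"
| cspan_uminus: "x \<in> cspan S \<Longrightarrow> - x \<in> cspan S"
| cspan_diff: "x \<in> cspan S \<Longrightarrow> y \<in> cspan S \<Longrightarrow> x - y \<in> cspan S"

section \<open>Algebraic tensor product over the complex numbers\<close>

text \<open>The algebraic tensor product A (x) B is realised as the span of the evaluation
  functionals  beta |-> beta a b  on the space of bilinear forms A x B -> C
  (the canonical image of A (x) B in its double dual, which is injective).\<close>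

definition tphi :: "'a::cvec \<Rightarrow> 'b::cvec \<Rightarrow> (('a \<Rightarrow> 'b \<Rightarrow> complex) \<Rightarrow> complex)" where
  "tphi a b = (\<lambda>\<beta>. if cbilinear \<beta> then \<beta> a b else 0)"

typedef (overloaded) ('a::cvec, 'b::cvec) tensor = "cspan (range (\<lambda>(a::'a, b::'b). tphi a b))"
  morphisms rep_tensor abs_tensor
  by (rule exI[of _ 0]) (rule cspan_zero)

setup_lifting type_definition_tensor

instantiation tensor :: (cvec, cvec) cvec
begin
lift_definition zero_tensor :: "('a, 'b) tensor" is 0 by (rule cspan_zero)
lift_definition plus_tensor :: "('a, 'b) tensor \<Rightarrow> ('a, 'b) tensor \<Rightarrow> ('a, 'b) tensor" is "(+)"
  by (rule cspan_add)
lift_definition minus_tensor :: "('a, 'b) tensor \<Rightarrow> ('a, 'b) tensor \<Rightarrow> ('a, 'b) tensor" is "(-)"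
  by (rule cspan_diff)
lift_definition uminus_tensor :: "('a, 'b) tensor \<Rightarrow> ('a, 'b) tensor" is uminus
  by (rule cspan_uminus)
lift_definition scaleC_tensor :: "complex \<Rightarrow> ('a, 'b) tensor \<Rightarrow> ('a, 'b) tensor" is scaleC
  by (rule cspan_scale)
instance
  by standard (transfer; simp add: algebra_simps scaleC_add_right scaleC_add_left scaleC_scaleC scaleC_one)+
end

lift_definition tensor :: "'a::cvec \<Rightarrow> 'b::cvec \<Rightarrow> ('a, 'b) tensor" (infixr "\<otimes>" 70) is tphi
  by (auto intro: cspan_base)

text \<open>Linear extension of a bilinear map along the tensor product
  (the unique linear map g with g (a \<otimes> b) = F a b).\<close>
definition tlift :: "('a::cvec \<Rightarrow> 'b::cvec \<Rightarrow> 'c::cvec) \<Rightarrow> ('a, 'b) tensor \<Rightarrow> 'c" where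
  "tlift F = (SOME g. clinear g \<and> (\<forall>a b. g (a \<otimes> b) = F a b))"

definition tmap :: "('a::cvec \<Rightarrow> 'c::cvec) \<Rightarrow> ('b::cvec \<Rightarrow> 'd::cvec) \<Rightarrow> ('a, 'b) tensor \<Rightarrow> ('c, 'd) tensor" where
  "tmap f g = tlift (\<lambda>a b. f a \<otimes> g b)"

section \<open>Formal series\<close>

text \<open>A formal series in one variable is represented by its coefficient function
  int => coefficient (coefficient of x^m at m); in two variables x1, x2 by
  int => int => coefficient (coefficient of x1^i x2^j at i j).\<close>

text \<open>Scalar Laurent series C((x)).\<close>
typedef laurent = "{f :: int \<Rightarrow> complex. \<exists>N. \<forall>n<N. f n = 0}"
  morphisms lcoeff Abs_laurent
  by (rule exI[of _ 0]) auto

setup_lifting type_definition_laurent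

instantiation laurent :: cvec
begin
lift_definition zero_laurent :: laurent is 0 by auto
lift_definition plus_laurent :: "laurent \<Rightarrow> laurent \<Rightarrow> laurent" is "(+)"
proof -
  fix f g :: "int \<Rightarrow> complex"
  assume "\<exists>N. \<forall>n<N. f n = 0" "\<exists>N. \<forall>n<N. g n = 0"
  then obtain N M where "\<forall>n<N. f n = 0" "\<forall>n<M. g n = 0" by blast
  then show "\<exists>N. \<forall>n<N. (f + g) n = 0" by (intro exI[of _ "min N M"]) auto
qed
lift_definition minus_laurent :: "laurent \<Rightarrow> laurent \<Rightarrow> laurent" is "(-)"
proof -
  fix f g :: "int \<Rightarrow> complex"
  assume "\<exists>N. \<forall>n<N. f n = 0" "\<exists>N. \<forall>n<N. g n = 0"
  then obtain N M where "\<forall>n<N. f n = 0" "\<forall>n<M. g n = 0" by blast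
  then show "\<exists>N. \<forall>n<N. (f - g) n = 0" by (intro exI[of _ "min N M"]) auto
qed
lift_definition uminus_laurent :: "laurent \<Rightarrow> laurent" is uminus by auto
lift_definition scaleC_laurent :: "complex \<Rightarrow> laurent \<Rightarrow> laurent" is scaleC
  by (auto simp: scaleC_fun_def scaleC_complex_def)
instance
  by standard (transfer; simp add: algebra_simps scaleC_add_right scaleC_add_left scaleC_scaleC scaleC_one)+
end

lift_definition lone :: laurent is "\<lambda>n. if n = 0 then 1 else 0"
  by (rule exI[of _ 0]) auto

text \<open>Formal products of series.  The coefficient of a product is the sum over
  the (in all uses below, finite) set of index pairs where both factors are nonzero.\<close>
definition conv :: "('a::zero \<Rightarrow> 'b::zero \<Rightarrow> 'c::comm_monoid_add) \<Rightarrow> (int \<Rightarrow> 'a) \<Rightarrow> (int \<Rightarrow> 'b) \<Rightarrow> int \<Rightarrow> 'c" where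
  "conv B f g m = (\<Sum>p\<in>{p. f p \<noteq> 0 \<and> g (m - p) \<noteq> 0}. B (f p) (g (m - p)))"

definition conv2 :: "('a::zero \<Rightarrow> 'b::zero \<Rightarrow> 'c::comm_monoid_add) \<Rightarrow> (int \<Rightarrow> int \<Rightarrow> 'a) \<Rightarrow> (int \<Rightarrow> int \<Rightarrow> 'b) \<Rightarrow> int \<Rightarrow> int \<Rightarrow> 'c" where
  "conv2 B F G i j = (\<Sum>(p, q)\<in>{(p, q). F p q \<noteq> 0 \<and> G (i - p) (j - q) \<noteq> 0}. B (F p q) (G (i - p) (j - q)))"

text \<open>s(-x) from s(x).\<close>
definition negser :: "(int \<Rightarrow> 'a::cvec) \<Rightarrow> int \<Rightarrow> 'a" where
  "negser s m = (if even m then s m else - s m)"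

text \<open>f(x1 + x2) and f(x1 - x2), expanded in nonnegative powers of x2.\<close>
definition ser_plus :: "(int \<Rightarrow> complex) \<Rightarrow> int \<Rightarrow> int \<Rightarrow> complex" where
  "ser_plus f i j = (if 0 \<le> j then (of_int (i + j) gchoose nat j) * f (i + j) else 0)"

definition ser_minus :: "(int \<Rightarrow> complex) \<Rightarrow> int \<Rightarrow> int \<Rightarrow> complex" where
  "ser_minus f i j = (if 0 \<le> j then (-1) ^ nat j * (of_int (i + j) gchoose nat j) * f (i + j) else 0)"

text \<open>A series in x1 alone, and a series in x2 alone, viewed as two-variable series.\<close>
definition in_x1 :: "(int \<Rightarrow> 'a::zero) \<Rightarrow> int \<Rightarrow> int \<Rightarrow> 'a" where
  "in_x1 s i j = (if j = 0 then s i else 0)"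
definition in_x2 :: "(int \<Rightarrow> 'a::zero) \<Rightarrow> int \<Rightarrow> int \<Rightarrow> 'a" where
  "in_x2 s i j = (if i = 0 then s j else 0)"

text \<open>Given a two-variable series F(x1, x2), the series F(x0 + x2, x2) in (x0, x2),
  x1 = x0 + x2 expanded in nonnegative powers of x2.\<close>
definition subst_plus :: "(int \<Rightarrow> int \<Rightarrow> 'a::cvec) \<Rightarrow> int \<Rightarrow> int \<Rightarrow> 'a" where
  "subst_plus F a b = (\<Sum>l\<in>{l::nat. F (a + int l) (b - int l) \<noteq> 0}.
      ((of_int (a + int l) :: complex) gchoose l) *\<^sub>C F (a + int l) (b - int l))"

text \<open>Multiplication of a two-variable series by the polynomial (x0 + x2)^k.\<close>
definition mult_binom :: "nat \<Rightarrow> (int \<Rightarrow> int \<Rightarrow> 'a::cvec) \<Rightarrow> int \<Rightarrow> int \<Rightarrow> 'a" where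
  "mult_binom k G a b = (\<Sum>t\<le>k. (of_nat (k choose t) :: complex) *\<^sub>C G (a - int (k - t)) (b - int t))"

text \<open>e^{xD} applied to a series s(x).\<close>
definition exp_act :: "('a::cvec \<Rightarrow> 'a) \<Rightarrow> (int \<Rightarrow> 'a) \<Rightarrow> int \<Rightarrow> 'a" where
  "exp_act D s m = (\<Sum>k\<in>{k::nat. s (m - int k) \<noteq> 0}. (1 / of_nat (fact k) :: complex) *\<^sub>C (D ^^ k) (s (m - int k)))"

section \<open>Nonlocal vertex algebras\<close>

text \<open>Y u v n is the mode u_n v, so Y(u,x)v = sum_n (Y u v n) x^(-n-1).
  The coefficient of x^m in Y(u,x)v is Y u v (-m-1).\<close>

definition yser :: "('a \<Rightarrow> 'a \<Rightarrow> int \<Rightarrow> 'a) \<Rightarrow> 'a \<Rightarrow> 'a \<Rightarrow> int \<Rightarrow> 'a" where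
  "yser Y u v m = Y u v (- m - 1)"

text \<open>(x0+x2)^k Y(u,x0+x2) Y(v,x2) w  and  (x0+x2)^k Y(Y(u,x0)v,x2) w.\<close>
definition assoc_lhs :: "('a::cvec \<Rightarrow> 'a \<Rightarrow> int \<Rightarrow> 'a) \<Rightarrow> nat \<Rightarrow> 'a \<Rightarrow> 'a \<Rightarrow> 'a \<Rightarrow> int \<Rightarrow> int \<Rightarrow> 'a" where
  "assoc_lhs Y k u v w = mult_binom k (subst_plus (\<lambda>i j. yser Y u (yser Y v w j) i))"

definition assoc_rhs :: "('a::cvec \<Rightarrow> 'a \<Rightarrow> int \<Rightarrow> 'a) \<Rightarrow> nat \<Rightarrow> 'a \<Rightarrow> 'a \<Rightarrow> 'a \<Rightarrow> int \<Rightarrow> int \<Rightarrow> 'a" where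
  "assoc_rhs Y k u v w = mult_binom k (\<lambda>a b. yser Y (yser Y u v a) w b)"

definition nlva :: "('a::cvec \<Rightarrow> 'a \<Rightarrow> int \<Rightarrow> 'a) \<Rightarrow> 'a \<Rightarrow> bool" where
  "nlva Y one \<longleftrightarrow>
     cbilinear Y \<and>
     (\<forall>u v. \<exists>N. \<forall>n>N. Y u v n = 0) \<and>
     (\<forall>v n. Y one v n = (if n = -1 then v else 0)) \<and>
     (\<forall>v n. 0 \<le> n \<longrightarrow> Y v one n = 0) \<and>
     (\<forall>v. Y v one (-1) = v) \<and>
     (\<forall>u v w. \<exists>k. \<forall>a b. assoc_lhs Y k u v w a b = assoc_rhs Y k u v w a b)"

definition Dop :: "('a \<Rightarrow> 'a \<Rightarrow> int \<Rightarrow> 'a) \<Rightarrow> 'a \<Rightarrow> 'a \<Rightarrow> 'a" where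
  "Dop Y one v = Y v one (-2)"

section \<open>Twisting operators and twisted tensor products\<close>

type_synonym ('u, 'v) twop = "('v, 'u) tensor \<Rightarrow> (('u, 'v) tensor, laurent) tensor"

text \<open>Evaluation of an element of (U \<otimes> V) \<otimes> C((x)) as a series with coefficients in U \<otimes> V.\<close>
definition evser :: "(('u::cvec, 'v::cvec) tensor, laurent) tensor \<Rightarrow> int \<Rightarrow> ('u, 'v) tensor" where
  "evser = tlift (\<lambda>t f. (\<lambda>m. lcoeff f m *\<^sub>C t))"

text \<open>R(x1)(1 \<otimes> Y(x2)) applied to v \<otimes> u \<otimes> u'.\<close>
definition tw1_lhs :: "('u::cvec \<Rightarrow> 'u \<Rightarrow> int \<Rightarrow> 'u) \<Rightarrow> ('u, 'v::cvec) twop \<Rightarrow> 'v \<Rightarrow> 'u \<Rightarrow> 'u \<Rightarrow> int \<Rightarrow> int \<Rightarrow> ('u, 'v) tensor" where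
  "tw1_lhs Yu R v u u' i j = evser (R (v \<otimes> yser Yu u u' j)) i"

text \<open>(Y(x2) \<otimes> 1) R^23(x1) R^12(x1+x2) applied to v \<otimes> u \<otimes> u'.\<close>
definition tw1_rhs :: "('u::cvec \<Rightarrow> 'u \<Rightarrow> int \<Rightarrow> 'u) \<Rightarrow> ('u, 'v::cvec) twop \<Rightarrow> 'v \<Rightarrow> 'u \<Rightarrow> 'u \<Rightarrow> int \<Rightarrow> int \<Rightarrow> ('u, 'v) tensor" where
  "tw1_rhs Yu R v u u' =
     tlift (\<lambda>t f. tlift (\<lambda>a b.
        tlift (\<lambda>t' g. tlift (\<lambda>c d.
           conv2 (*\<^sub>C) (conv2 (*) (ser_plus (lcoeff f)) (in_x1 (lcoeff g)))
                 (in_x2 (\<lambda>j. yser Yu a c j \<otimes> d))) t') (R (b \<otimes> u'))) t) (R (v \<otimes> u))"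

text \<open>R(x1)(Y(x2) \<otimes> 1) applied to v \<otimes> v' \<otimes> u.\<close>
definition tw2_lhs :: "('v::cvec \<Rightarrow> 'v \<Rightarrow> int \<Rightarrow> 'v) \<Rightarrow> ('u::cvec, 'v) twop \<Rightarrow> 'v \<Rightarrow> 'v \<Rightarrow> 'u \<Rightarrow> int \<Rightarrow> int \<Rightarrow> ('u, 'v) tensor" where
  "tw2_lhs Yv R v v' u i j = evser (R (yser Yv v v' j \<otimes> u)) i"

text \<open>(1 \<otimes> Y(x2)) R^12(x1-x2) R^23(x1) applied to v \<otimes> v' \<otimes> u.\<close>
definition tw2_rhs :: "('v::cvec \<Rightarrow> 'v \<Rightarrow> int \<Rightarrow> 'v) \<Rightarrow> ('u::cvec, 'v) twop \<Rightarrow> 'v \<Rightarrow> 'v \<Rightarrow> 'u \<Rightarrow> int \<Rightarrow> int \<Rightarrow> ('u, 'v) tensor" where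
  "tw2_rhs Yv R v v' u =
     tlift (\<lambda>t g. tlift (\<lambda>a b.
        tlift (\<lambda>t' f. tlift (\<lambda>c d.
           conv2 (*\<^sub>C) (conv2 (*) (ser_minus (lcoeff f)) (in_x1 (lcoeff g)))
                 (in_x2 (\<lambda>j. c \<otimes> yser Yv d b j))) t') (R (v \<otimes> a))) t) (R (v' \<otimes> u))"

definition twisting_operator ::
  "('u::cvec \<Rightarrow> 'u \<Rightarrow> int \<Rightarrow> 'u) \<Rightarrow> 'u \<Rightarrow> ('v::cvec \<Rightarrow> 'v \<Rightarrow> int \<Rightarrow> 'v) \<Rightarrow> 'v \<Rightarrow> ('u, 'v) twop \<Rightarrow> bool" where
  "twisting_operator Yu oneu Yv onev R \<longleftrightarrow>
     clinear R \<and>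
     (\<forall>v. R (v \<otimes> oneu) = (oneu \<otimes> v) \<otimes> lone) \<and>
     (\<forall>u. R (onev \<otimes> u) = (u \<otimes> onev) \<otimes> lone) \<and>
     (\<forall>v u u'. tw1_lhs Yu R v u u' = tw1_rhs Yu R v u u') \<and>
     (\<forall>v v' u. tw2_lhs Yv R v v' u = tw2_rhs Yv R v v' u)"

text \<open>Y_R(w, x) w' as a series (coefficient of x^m):
  Y_R(u \<otimes> v, x)(u' \<otimes> v') = sum_i f_i(-x) Y(u,x)u'_i \<otimes> Y(v_i,x)v',
  where R(x)(v \<otimes> u') = sum_i u'_i \<otimes> v_i \<otimes> f_i(x).\<close>
definition YR_simple :: "('u::cvec \<Rightarrow> 'u \<Rightarrow> int \<Rightarrow> 'u) \<Rightarrow> ('v::cvec \<Rightarrow> 'v \<Rightarrow> int \<Rightarrow> 'v) \<Rightarrow> ('u, 'v) twop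
    \<Rightarrow> 'u \<Rightarrow> 'v \<Rightarrow> 'u \<Rightarrow> 'v \<Rightarrow> int \<Rightarrow> ('u, 'v) tensor" where
  "YR_simple Yu Yv R u v u' v' =
     tlift (\<lambda>t f. tlift (\<lambda>a b.
        conv (*\<^sub>C) (negser (lcoeff f)) (conv (\<otimes>) (yser Yu u a) (yser Yv b v'))) t) (R (v \<otimes> u'))"

definition YRser :: "('u::cvec \<Rightarrow> 'u \<Rightarrow> int \<Rightarrow> 'u) \<Rightarrow> ('v::cvec \<Rightarrow> 'v \<Rightarrow> int \<Rightarrow> 'v) \<Rightarrow> ('u, 'v) twop
    \<Rightarrow> ('u, 'v) tensor \<Rightarrow> ('u, 'v) tensor \<Rightarrow> int \<Rightarrow> ('u, 'v) tensor" where
  "YRser Yu Yv R = tlift (\<lambda>u v. tlift (\<lambda>u' v'. YR_simple Yu Yv R u v u' v'))"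

text \<open>The vertex operator of U \<otimes>_R V in mode form: YR w w' n = w_n w'.\<close>
definition YR :: "('u::cvec \<Rightarrow> 'u \<Rightarrow> int \<Rightarrow> 'u) \<Rightarrow> ('v::cvec \<Rightarrow> 'v \<Rightarrow> int \<Rightarrow> 'v) \<Rightarrow> ('u, 'v) twop
    \<Rightarrow> ('u, 'v) tensor \<Rightarrow> ('u, 'v) tensor \<Rightarrow> int \<Rightarrow> ('u, 'v) tensor" where
  "YR Yu Yv R w w' n = YRser Yu Yv R w w' (- n - 1)"

end

theory Submission
  imports Defs
begin

text \<open>Since
  \<open>R(x)(v \<otimes> 1) = 1 \<otimes> v\<close>, the operator \<open>Y_R(a \<otimes> b, x)\<close> applied to \<open>1 \<otimes> v'\<close> is
  \<open>Y(a, x)1 \<otimes> Y(b, x)v'\<close>. Taking \<open>v' = 1\<close> and the coefficient of \<open>x\<close> identifies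
  \<open>\<D>\<close>; taking \<open>b = 1\<close> shows that \<open>Y_R(u, x)v = Y(u, x)1 \<otimes> v\<close> is regular. Weak
  associativity for \<open>(u, 1, 1)\<close> yields the creation property \<open>Y(u, x)1 = e^{x\<D>}u\<close>,
  so, \<open>\<D> \<otimes> 1\<close> and \<open>1 \<otimes> \<D>\<close> commuting,
  \<open>e^{x(\<D> \<otimes> 1 + 1 \<otimes> \<D>)} (Y(a, -x)1 \<otimes> b) = e^{x(1 \<otimes> \<D>)} (a \<otimes> b) = a \<otimes> Y(b, x)1\<close>.
  Skew symmetry follows by writing \<open>Y_R(v, x)u = \<Sum>\<^sub>i f\<^sub>i(-x) u\<^sub>i \<otimes> Y(v\<^sub>i, x)1\<close> and
  extending linearly over \<open>R(x)(v \<otimes> u)\<close>.\<close>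

section \<open>Complex vector spaces and linear maps\<close>

lemma scaleC_zero_left [simp]: "(0::complex) *\<^sub>C (x::'a::cvec) = 0"
  by (metis add_cancel_right_right add_0_left scaleC_add_left)

lemma scaleC_zero_right [simp]: "c *\<^sub>C (0::'a::cvec) = 0"
  by (metis add_cancel_right_right add_0_left scaleC_add_right)

lemma scaleC_minus_left: "(- c) *\<^sub>C (x::'a::cvec) = - (c *\<^sub>C x)"
  by (metis add.right_inverse add_eq_0_iff scaleC_add_left scaleC_zero_left)

lemma scaleC_minus_right: "c *\<^sub>C (- (x::'a::cvec)) = - (c *\<^sub>C x)"
  by (metis add.right_inverse add_eq_0_iff scaleC_add_right scaleC_zero_right)

lemma scaleC_minus1_left: "(-1) *\<^sub>C (x::'a::cvec) = - x"
  by (simp add: scaleC_minus_left scaleC_one)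

lemma scaleC_diff_right: "c *\<^sub>C ((x::'a::cvec) - y) = c *\<^sub>C x - c *\<^sub>C y"
  by (simp only: diff_conv_add_uminus scaleC_add_right scaleC_minus_right)

lemma scaleC_sum_right: "c *\<^sub>C sum f A = (\<Sum>i\<in>A. c *\<^sub>C (f i :: 'a::cvec))"
  by (induction A rule: infinite_finite_induct) (auto simp: scaleC_add_right)

lemma scaleC_complex_eq [simp]: "c *\<^sub>C (z::complex) = c * z"
  by (simp add: scaleC_complex_def)

lemma scaleC_fun_apply [simp]: "(c *\<^sub>C f) x = c *\<^sub>C (f x :: 'b::cvec)"
  by (simp add: scaleC_fun_def)

lemma clinearI: "(\<And>x y. f (x + y) = f x + f y) \<Longrightarrow> (\<And>c x. f (c *\<^sub>C x) = c *\<^sub>C f x) \<Longrightarrow> clinear f"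
  by (auto simp: clinear_def)

lemma clinear_add: "clinear f \<Longrightarrow> f (x + y) = f x + f y"
  by (simp add: clinear_def)

lemma clinear_scale: "clinear f \<Longrightarrow> f (c *\<^sub>C x) = c *\<^sub>C f x"
  by (simp add: clinear_def)

lemma clinear_zero: "clinear f \<Longrightarrow> f 0 = 0"
  using clinear_scale[of f 0 0] by simp

lemma clinear_uminus: "clinear f \<Longrightarrow> f (- x) = - f x"
  by (metis add.right_inverse add_eq_0_iff clinear_add clinear_zero)

lemma clinear_diff: "clinear f \<Longrightarrow> f (x - y) = f x - f y"
  by (simp only: clinear_add clinear_uminus diff_conv_add_uminus)

lemma clinear_sum: "clinear f \<Longrightarrow> f (sum g A) = (\<Sum>i\<in>A. f (g i))"
  by (induction A rule: infinite_finite_induct) (auto simp: clinear_add clinear_zero)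

lemma clinear_id: "clinear id"
  by (simp add: clinear_def)

lemma clinear_comp: "clinear f \<Longrightarrow> clinear g \<Longrightarrow> clinear (\<lambda>x. f (g x))"
  by (simp add: clinear_def)

lemma clinear_plus: "clinear f \<Longrightarrow> clinear g \<Longrightarrow> clinear (\<lambda>x. f x + g x)"
  by (simp add: clinear_def scaleC_add_right)

lemma clinear_scaleC: "clinear f \<Longrightarrow> clinear (\<lambda>x. c *\<^sub>C (f x :: 'a::cvec))"
  by (auto simp: clinear_def scaleC_add_right scaleC_scaleC mult.commute)

lemma clinear_funpow:
  fixes f :: "'a::cvec \<Rightarrow> 'a"
  assumes "clinear f"
  shows "clinear (f ^^ n)"
  by (induction n) (simp_all add: clinear_id[unfolded id_def] clinear_comp[OF assms] o_def)

lemma clinear_funI: "(\<And>t. clinear (\<lambda>p. F p t)) \<Longrightarrow> clinear F"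
  by (auto simp: clinear_def fun_eq_iff)

lemma clinear_fun_apply: "clinear F \<Longrightarrow> clinear (\<lambda>p. F p t)"
  by (auto simp: clinear_def)

lemma cbilinearI: "(\<And>y. clinear (\<lambda>x. f x y)) \<Longrightarrow> (\<And>x. clinear (f x)) \<Longrightarrow> cbilinear f"
  by (simp add: cbilinear_def)

lemma cbilinear_linear_left: "cbilinear f \<Longrightarrow> clinear (\<lambda>x. f x y)"
  by (simp add: cbilinear_def)

lemma cbilinear_linear_right: "cbilinear f \<Longrightarrow> clinear (f x)"
  by (simp add: cbilinear_def)

lemma cbilinear_zero_left: "cbilinear f \<Longrightarrow> f 0 y = 0"
  using clinear_zero[OF cbilinear_linear_left] by blast

lemma cbilinear_zero_right: "cbilinear f \<Longrightarrow> f x 0 = 0"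
  using clinear_zero[OF cbilinear_linear_right] by blast

lemma cbilinear_scaleC: "cbilinear ((*\<^sub>C) :: complex \<Rightarrow> 'a::cvec \<Rightarrow> 'a)"
  by (auto simp: cbilinear_def clinear_def scaleC_add_left scaleC_add_right scaleC_scaleC mult.commute)

lemma cspan_least:
  assumes "S \<subseteq> M" "0 \<in> M" "\<And>x y. x \<in> M \<Longrightarrow> y \<in> M \<Longrightarrow> x + y \<in> M"
    and "\<And>c x. x \<in> M \<Longrightarrow> c *\<^sub>C x \<in> M"
  shows "cspan S \<subseteq> M"
proof
  fix x assume "x \<in> cspan S"
  then show "x \<in> M"
  proof induction
    case (cspan_uminus x)
    then show ?case using assms(4)[of x "-1"] by (simp add: scaleC_minus1_left)
  next
    case (cspan_diff x y)
    then show ?case using assms(3)[of x "(-1) *\<^sub>C y"] assms(4)[of y "-1"] by (simp add: scaleC_minus1_left)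
  qed (use assms in auto)
qed

text \<open>The linear extension \<open>tlift\<close> is constructed by duality, so its target must
  be separated by linear functionals.\<close>

class sep_cvec = cvec +
  assumes separating_functional_raw: "x \<noteq> 0 \<Longrightarrow> \<exists>\<phi>::'a \<Rightarrow> complex.
    (\<forall>x y. \<phi> (x + y) = \<phi> x + \<phi> y) \<and> (\<forall>c x. \<phi> (c *\<^sub>C x) = c * \<phi> x) \<and> \<phi> x \<noteq> 0"

lemma separating_functional: "(x::'a::sep_cvec) \<noteq> 0 \<Longrightarrow> \<exists>\<phi>::'a \<Rightarrow> complex. clinear \<phi> \<and> \<phi> x \<noteq> 0"
  using separating_functional_raw[of x] by (auto simp: clinear_def)

lemma sep_cvec_eqI:
  fixes x y :: "'a::sep_cvec"
  assumes "\<And>\<phi>::'a \<Rightarrow> complex. clinear \<phi> \<Longrightarrow> \<phi> x = \<phi> y"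
  shows "x = y"
proof (rule ccontr)
  assume "x \<noteq> y"
  then obtain \<phi> :: "'a \<Rightarrow> complex" where "clinear \<phi>" "\<phi> (x - y) \<noteq> 0"
    using separating_functional[of "x - y"] by auto
  with assms show False by (simp add: clinear_diff)
qed

instance complex :: sep_cvec
  by standard (rule exI[of _ id], simp)

instance "fun" :: (type, sep_cvec) sep_cvec
proof
  fix x :: "'a \<Rightarrow> 'b"
  assume "x \<noteq> 0"
  then obtain i where "x i \<noteq> 0" by (metis ext zero_fun_def)
  then obtain \<phi> :: "'b \<Rightarrow> complex" where "clinear \<phi>" "\<phi> (x i) \<noteq> 0"
    using separating_functional by blast
  then show "\<exists>\<phi>::('a \<Rightarrow> 'b) \<Rightarrow> complex.
      (\<forall>x y. \<phi> (x + y) = \<phi> x + \<phi> y) \<and> (\<forall>c x. \<phi> (c *\<^sub>C x) = c * \<phi> x) \<and> \<phi> x \<noteq> 0"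
    by (intro exI[of _ "\<lambda>f. \<phi> (f i)"]) (auto simp: clinear_def)
qed

instance tensor :: (cvec, cvec) sep_cvec
proof
  fix x :: "('a, 'b) tensor"
  assume "x \<noteq> 0"
  then have "rep_tensor x \<noteq> 0" by (metis rep_tensor_inject zero_tensor.rep_eq)
  then obtain \<beta> where "rep_tensor x \<beta> \<noteq> 0" by (metis ext zero_fun_def)
  then show "\<exists>\<phi>::('a, 'b) tensor \<Rightarrow> complex.
      (\<forall>x y. \<phi> (x + y) = \<phi> x + \<phi> y) \<and> (\<forall>c x. \<phi> (c *\<^sub>C x) = c * \<phi> x) \<and> \<phi> x \<noteq> 0"
    by (intro exI[of _ "\<lambda>t. rep_tensor t \<beta>"]) (simp add: plus_tensor.rep_eq scaleC_tensor.rep_eq)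
qed

section \<open>Tensor products and linear extension\<close>

lemma cbilinear_tensor: "cbilinear (\<otimes>)"
  unfolding cbilinear_def clinear_def
  by transfer (auto simp: fun_eq_iff tphi_def cbilinear_def clinear_def)

lemmas tensor_add_left = clinear_add[OF cbilinear_linear_left[OF cbilinear_tensor]]
lemmas tensor_add_right = clinear_add[OF cbilinear_linear_right[OF cbilinear_tensor]]
lemmas tensor_scale_left = clinear_scale[OF cbilinear_linear_left[OF cbilinear_tensor]]
lemmas tensor_scale_right = clinear_scale[OF cbilinear_linear_right[OF cbilinear_tensor]]

lemma tensor_zero_left [simp]: "0 \<otimes> b = 0"
  using cbilinear_zero_left[OF cbilinear_tensor] .

lemma tensor_induct [case_names zero pure add scale]:
  assumes "P 0" "\<And>a b. P (a \<otimes> b)" "\<And>x y. P x \<Longrightarrow> P y \<Longrightarrow> P (x + y)"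
    and "\<And>c x. P x \<Longrightarrow> P (c *\<^sub>C x)"
  shows "P t"
proof -
  let ?B = "range (\<lambda>(a::'a, b::'b). tphi a b)"
  have "cspan ?B \<subseteq> {x \<in> cspan ?B. P (abs_tensor x)}"
  proof (rule cspan_least)
    show "?B \<subseteq> {x \<in> cspan ?B. P (abs_tensor x)}"
      using assms(2) by (auto intro: cspan_base simp: tensor_def)
    show "0 \<in> {x \<in> cspan ?B. P (abs_tensor x)}"
      using assms(1) by (simp add: cspan_zero zero_tensor_def)
  next
    fix x y assume "x \<in> {x \<in> cspan ?B. P (abs_tensor x)}" "y \<in> {x \<in> cspan ?B. P (abs_tensor x)}"
    then show "x + y \<in> {x \<in> cspan ?B. P (abs_tensor x)}"
      using assms(3)[of "abs_tensor x" "abs_tensor y"]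
      by (auto intro: cspan_add simp: plus_tensor_def abs_tensor_inverse)
  next
    fix c x assume "x \<in> {x \<in> cspan ?B. P (abs_tensor x)}"
    then show "c *\<^sub>C x \<in> {x \<in> cspan ?B. P (abs_tensor x)}"
      using assms(4)[of "abs_tensor x" c]
      by (auto intro: cspan_scale simp: scaleC_tensor_def abs_tensor_inverse)
  qed
  then show ?thesis
    using rep_tensor[of t] by (auto simp: rep_tensor_inverse)
qed

lemma tensor_linear_eqI:
  assumes "clinear g" "clinear h" "\<And>a b. g (a \<otimes> b) = h (a \<otimes> b)"
  shows "g t = h t"
  by (induction t rule: tensor_induct) (use assms in \<open>simp_all add: clinear_zero clinear_add clinear_scale\<close>)

text \<open>The linear extension of \<open>F\<close> is constructed functional by functional: for
  \<open>t\<close> in the span of the evaluations \<open>tphi a b\<close>, the value is the vector \<open>c\<close> with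
  \<open>\<phi> c = t (\<lambda>a b. \<phi> (F a b))\<close> for all functionals \<open>\<phi>\<close>.\<close>

lemma tlift_exists:
  fixes F :: "'a::cvec \<Rightarrow> 'b::cvec \<Rightarrow> 'c::sep_cvec"
  assumes F: "cbilinear F"
  shows "\<exists>g. clinear g \<and> (\<forall>a b. g (a \<otimes> b) = F a b)"
proof -
  define represented where "represented x c \<longleftrightarrow>
    (\<forall>\<phi>::'c \<Rightarrow> complex. clinear \<phi> \<longrightarrow> \<phi> c = x (\<lambda>a b. \<phi> (F a b)))" for x c
  have F_tphi: "represented (tphi a b) (F a b)" for a b
    using F by (auto simp: represented_def tphi_def cbilinear_def clinear_def)
  have "cspan (range (\<lambda>(a, b). tphi a b)) \<subseteq> {x. \<exists>c. represented x c}"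
  proof (rule cspan_least)
    show "range (\<lambda>(a, b). tphi a b) \<subseteq> {x. \<exists>c. represented x c}"
      using F_tphi by auto
    show "0 \<in> {x. \<exists>c. represented x c}"
      by (auto simp: represented_def clinear_zero intro: exI[of _ 0])
  next
    fix x y assume "x \<in> {x. \<exists>c. represented x c}" "y \<in> {x. \<exists>c. represented x c}"
    then obtain c d where "represented x c" "represented y d" by blast
    then have "represented (x + y) (c + d)" by (simp add: represented_def clinear_add)
    then show "x + y \<in> {x. \<exists>c. represented x c}" by blast
  next
    fix e x assume "x \<in> {x. \<exists>c. represented x c}"
    then obtain c where "represented x c" by blast
    then have "represented (e *\<^sub>C x) (e *\<^sub>C c)" by (simp add: represented_def clinear_scale)
    then show "e *\<^sub>C x \<in> {x. \<exists>c. represented x c}" by blast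
  qed
  then have ex: "\<exists>c. represented (rep_tensor t) c" for t
    using rep_tensor[of t] by blast
  define g where "g t = (SOME c. represented (rep_tensor t) c)" for t
  have g: "represented (rep_tensor t) (g t)" for t
    unfolding g_def by (rule someI_ex[OF ex])
  have g_eq: "g t = c" if "represented (rep_tensor t) c" for t c
    by (rule sep_cvec_eqI) (use g that in \<open>auto simp: represented_def\<close>)
  have "clinear g"
  proof (rule clinearI)
    fix x y show "g (x + y) = g x + g y"
      by (rule g_eq) (use g in \<open>simp add: represented_def clinear_add plus_tensor.rep_eq\<close>)
  next
    fix c x show "g (c *\<^sub>C x) = c *\<^sub>C g x"
      by (rule g_eq) (use g in \<open>simp add: represented_def clinear_scale scaleC_tensor.rep_eq\<close>)
  qed
  moreover have "g (a \<otimes> b) = F a b" for a b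
    by (rule g_eq) (simp add: tensor.rep_eq F_tphi)
  ultimately show ?thesis by blast
qed

context
  fixes F :: "'a::cvec \<Rightarrow> 'b::cvec \<Rightarrow> 'c::sep_cvec"
  assumes F: "cbilinear F"
begin

lemma clinear_tlift: "clinear (tlift F)"
  using someI_ex[OF tlift_exists[OF F]] unfolding tlift_def by blast

lemma tlift_tensor [simp]: "tlift F (a \<otimes> b) = F a b"
  using someI_ex[OF tlift_exists[OF F]] unfolding tlift_def by blast

lemma tlift_unique: "clinear g \<Longrightarrow> (\<And>a b. g (a \<otimes> b) = F a b) \<Longrightarrow> tlift F t = g t"
  by (rule tensor_linear_eqI) (simp_all add: clinear_tlift)

end

lemma tlift_add:
  fixes F G :: "'a::cvec \<Rightarrow> 'b::cvec \<Rightarrow> 'c::sep_cvec"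
  assumes "cbilinear F" "cbilinear G"
  shows "tlift (\<lambda>a b. F a b + G a b) t = tlift F t + tlift G t"
proof (rule tlift_unique)
  show "cbilinear (\<lambda>a b. F a b + G a b)"
    using assms by (auto simp: cbilinear_def intro: clinear_plus)
qed (use assms in \<open>simp_all add: clinear_plus clinear_tlift\<close>)

lemma tlift_scale:
  fixes F :: "'a::cvec \<Rightarrow> 'b::cvec \<Rightarrow> 'c::sep_cvec"
  assumes "cbilinear F"
  shows "tlift (\<lambda>a b. c *\<^sub>C F a b) t = c *\<^sub>C tlift F t"
proof (rule tlift_unique)
  show "cbilinear (\<lambda>a b. c *\<^sub>C F a b)"
    using assms by (auto simp: cbilinear_def intro: clinear_scaleC)
qed (use assms in \<open>simp_all add: clinear_scaleC clinear_tlift\<close>)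

lemma clinear_tlift_param:
  fixes G :: "'p::cvec \<Rightarrow> 'a::cvec \<Rightarrow> 'b::cvec \<Rightarrow> 'c::sep_cvec"
  assumes "\<And>p. cbilinear (G p)" "\<And>a b. clinear (\<lambda>p. G p a b)"
  shows "clinear (\<lambda>p. tlift (G p) t)"
proof (rule clinearI)
  fix x y
  have "G (x + y) = (\<lambda>a b. G x a b + G y a b)"
    using clinear_add[OF assms(2)] by (simp add: fun_eq_iff)
  then show "tlift (G (x + y)) t = tlift (G x) t + tlift (G y) t"
    by (simp add: tlift_add assms(1))
next
  fix c x
  have "G (c *\<^sub>C x) = (\<lambda>a b. c *\<^sub>C G x a b)"
    using clinear_scale[OF assms(2)] by (simp add: fun_eq_iff)
  then show "tlift (G (c *\<^sub>C x)) t = c *\<^sub>C tlift (G x) t"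
    by (simp add: tlift_scale assms(1))
qed

lemma cbilinear_tlift_param:
  fixes G :: "'p::cvec \<Rightarrow> 'a::cvec \<Rightarrow> 'b::cvec \<Rightarrow> 'c::sep_cvec"
  assumes "\<And>p. cbilinear (G p)" "\<And>a b. clinear (\<lambda>p. G p a b)"
  shows "cbilinear (\<lambda>t p. tlift (G p) t)"
  using clinear_tlift_param[OF assms] clinear_tlift[OF assms(1)] by (auto simp: cbilinear_def)

lemma cbilinear_tlift_bilinear_param:
  fixes G :: "'p::cvec \<Rightarrow> 'q::cvec \<Rightarrow> 'a::cvec \<Rightarrow> 'b::cvec \<Rightarrow> 'c::sep_cvec"
  assumes "\<And>p q. cbilinear (G p q)"
    and "\<And>q a b. clinear (\<lambda>p. G p q a b)" "\<And>p a b. clinear (\<lambda>q. G p q a b)"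
  shows "cbilinear (\<lambda>p q. tlift (G p q))"
  by (intro cbilinearI clinear_funI clinear_tlift_param assms)

lemma
  fixes f :: "'a::cvec \<Rightarrow> 'c::cvec" and g :: "'b::cvec \<Rightarrow> 'd::cvec"
  assumes "clinear f" "clinear g"
  shows clinear_tmap: "clinear (tmap f g)" and tmap_tensor: "tmap f g (a \<otimes> b) = f a \<otimes> g b"
proof -
  have "cbilinear (\<lambda>a b. f a \<otimes> g b)"
    using assms by (auto simp: cbilinear_def clinear_def tensor_add_left tensor_add_right
        tensor_scale_left tensor_scale_right)
  then show "clinear (tmap f g)" "tmap f g (a \<otimes> b) = f a \<otimes> g b"
    unfolding tmap_def by (simp_all add: clinear_tlift)
qed

lemma tmap_funpow_tensor:
  fixes f :: "'a::cvec \<Rightarrow> 'a" and g :: "'b::cvec \<Rightarrow> 'b"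
  assumes "clinear f" "clinear g"
  shows "(tmap f g ^^ n) (a \<otimes> b) = (f ^^ n) a \<otimes> (g ^^ n) b"
  by (induction n) (simp_all add: tmap_tensor[OF assms])

section \<open>Formal series bounded below\<close>

definition vanishes_below :: "int \<Rightarrow> (int \<Rightarrow> 'a::zero) \<Rightarrow> bool" where
  "vanishes_below N s \<longleftrightarrow> (\<forall>m<N. s m = 0)"

definition bounded_below :: "(int \<Rightarrow> 'a::zero) \<Rightarrow> bool" where
  "bounded_below s \<longleftrightarrow> (\<exists>N. vanishes_below N s)"

lemma vanishes_below_mono: "vanishes_below N s \<Longrightarrow> M \<le> N \<Longrightarrow> vanishes_below M s"
  by (auto simp: vanishes_below_def)

lemma vanishes_below_nonzeroD: "vanishes_below N s \<Longrightarrow> s m \<noteq> 0 \<Longrightarrow> N \<le> m"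
  by (auto simp: vanishes_below_def not_less[symmetric])

lemma bounded_below_common:
  assumes "bounded_below s" "bounded_below t"
  obtains N where "vanishes_below N s" "vanishes_below N t"
proof -
  obtain N M where "vanishes_below N s" "vanishes_below M t"
    using assms by (auto simp: bounded_below_def)
  then show thesis
    by (intro that[of "min N M"]) (auto elim: vanishes_below_mono)
qed

lemma vanishes_below_add:
  "vanishes_below N s \<Longrightarrow> vanishes_below N t \<Longrightarrow> vanishes_below N (s + (t :: int \<Rightarrow> 'a::monoid_add))"
  by (auto simp: vanishes_below_def)

lemma vanishes_below_scale: "vanishes_below N s \<Longrightarrow> vanishes_below N (c *\<^sub>C (s :: int \<Rightarrow> 'a::cvec))"
  by (auto simp: vanishes_below_def)

lemma bounded_below_zero: "bounded_below 0"
  by (auto simp: bounded_below_def vanishes_below_def)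

lemma bounded_below_add:
  "bounded_below s \<Longrightarrow> bounded_below t \<Longrightarrow> bounded_below (s + (t :: int \<Rightarrow> 'a::monoid_add))"
  by (metis bounded_below_common bounded_below_def vanishes_below_add)

lemma bounded_below_scale: "bounded_below s \<Longrightarrow> bounded_below (c *\<^sub>C (s :: int \<Rightarrow> 'a::cvec))"
  unfolding bounded_below_def using vanishes_below_scale by blast

lemma vanishes_below_negser: "vanishes_below N s \<Longrightarrow> vanishes_below N (negser s)"
  by (auto simp: vanishes_below_def negser_def)

lemma bounded_below_negser: "bounded_below s \<Longrightarrow> bounded_below (negser s)"
  unfolding bounded_below_def using vanishes_below_negser by blast

lemma bounded_below_lcoeff: "bounded_below (lcoeff f)"
  using lcoeff[of f] by (auto simp: bounded_below_def vanishes_below_def)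

lemma bounded_below_tensor_left: "bounded_below s \<Longrightarrow> bounded_below (\<lambda>m. s m \<otimes> b)"
  unfolding bounded_below_def vanishes_below_def by (metis tensor_zero_left)

lemma clinear_negser: "clinear negser"
  by (rule clinearI) (auto simp: negser_def fun_eq_iff scaleC_minus_right)

lemma negser_nat: "negser s (int n) = ((-1) ^ n :: complex) *\<^sub>C s (int n)"
  by (simp add: negser_def scaleC_one scaleC_minus_left)

lemma negser_delta: "negser (\<lambda>n. if n = 0 then c else 0) = (\<lambda>n. if n = 0 then c else 0)"
  by (auto simp: negser_def fun_eq_iff)

lemma clinear_lcoeff: "clinear lcoeff"
  by (rule clinearI) (simp_all add: plus_laurent.rep_eq scaleC_laurent.rep_eq)

lemma conv_eq_sum_interval:
  assumes B: "cbilinear B" and "vanishes_below Nf f" "vanishes_below Ng g" "A \<le> Nf" "m - Ng \<le> C"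
  shows "conv B f g m = (\<Sum>p\<in>{A..C}. B (f p) (g (m - p)))"
  unfolding conv_def
proof (rule sum.mono_neutral_left)
  show "{p. f p \<noteq> 0 \<and> g (m - p) \<noteq> 0} \<subseteq> {A..C}"
    using assms(4,5) vanishes_below_nonzeroD[OF assms(2)] vanishes_below_nonzeroD[OF assms(3)]
    by fastforce
  show "\<forall>i\<in>{A..C} - {p. f p \<noteq> 0 \<and> g (m - p) \<noteq> 0}. B (f i) (g (m - i)) = 0"
    using cbilinear_zero_left[OF B] cbilinear_zero_right[OF B] by auto
qed simp

lemma vanishes_below_conv:
  assumes "vanishes_below Nf f" "vanishes_below Ng g"
  shows "vanishes_below (Nf + Ng) (conv B f g)"
proof -
  have "conv B f g m = 0" if "m < Nf + Ng" for m
  proof -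
    have "{p. f p \<noteq> 0 \<and> g (m - p) \<noteq> 0} = {}"
      using that vanishes_below_nonzeroD[OF assms(1)] vanishes_below_nonzeroD[OF assms(2)] by fastforce
    then show ?thesis unfolding conv_def by (simp only: sum.empty)
  qed
  then show ?thesis by (simp add: vanishes_below_def)
qed

lemma bounded_below_conv: "bounded_below f \<Longrightarrow> bounded_below g \<Longrightarrow> bounded_below (conv B f g)"
  unfolding bounded_below_def using vanishes_below_conv by blast

context
  fixes B :: "'a::cvec \<Rightarrow> 'b::cvec \<Rightarrow> 'c::cvec"
  assumes B: "cbilinear B"
begin

lemma conv_add_left:
  assumes "bounded_below f1" "bounded_below f2" "bounded_below g"
  shows "conv B (f1 + f2) g = conv B f1 g + conv B f2 g"
proof
  fix m
  obtain N where N: "vanishes_below N f1" "vanishes_below N f2" using assms(1,2) by (rule bounded_below_common)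
  obtain Ng where Ng: "vanishes_below Ng g" using assms(3) by (auto simp: bounded_below_def)
  show "conv B (f1 + f2) g m = (conv B f1 g + conv B f2 g) m"
    using conv_eq_sum_interval[OF B N(1) Ng order_refl order_refl]
      conv_eq_sum_interval[OF B N(2) Ng order_refl order_refl]
      conv_eq_sum_interval[OF B vanishes_below_add[OF N] Ng order_refl order_refl]
      clinear_add[OF cbilinear_linear_left[OF B]]
    by (simp add: sum.distrib)
qed

lemma conv_add_right:
  assumes "bounded_below f" "bounded_below g1" "bounded_below g2"
  shows "conv B f (g1 + g2) = conv B f g1 + conv B f g2"
proof
  fix m
  obtain N where N: "vanishes_below N g1" "vanishes_below N g2" using assms(2,3) by (rule bounded_below_common)
  obtain Nf where Nf: "vanishes_below Nf f" using assms(1) by (auto simp: bounded_below_def)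
  show "conv B f (g1 + g2) m = (conv B f g1 + conv B f g2) m"
    using conv_eq_sum_interval[OF B Nf N(1) order_refl order_refl]
      conv_eq_sum_interval[OF B Nf N(2) order_refl order_refl]
      conv_eq_sum_interval[OF B Nf vanishes_below_add[OF N] order_refl order_refl]
      clinear_add[OF cbilinear_linear_right[OF B]]
    by (simp add: sum.distrib)
qed

lemma conv_scale_left:
  assumes "bounded_below f" "bounded_below g"
  shows "conv B (c *\<^sub>C f) g = c *\<^sub>C conv B f g"
proof
  fix m
  obtain Nf Ng where N: "vanishes_below Nf f" "vanishes_below Ng g"
    using assms by (auto simp: bounded_below_def)
  show "conv B (c *\<^sub>C f) g m = (c *\<^sub>C conv B f g) m"
    using conv_eq_sum_interval[OF B N order_refl order_refl]
      conv_eq_sum_interval[OF B vanishes_below_scale[OF N(1)] N(2) order_refl order_refl]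
      clinear_scale[OF cbilinear_linear_left[OF B]]
    by (simp add: scaleC_sum_right)
qed

lemma conv_scale_right:
  assumes "bounded_below f" "bounded_below g"
  shows "conv B f (c *\<^sub>C g) = c *\<^sub>C conv B f g"
proof
  fix m
  obtain Nf Ng where N: "vanishes_below Nf f" "vanishes_below Ng g"
    using assms by (auto simp: bounded_below_def)
  show "conv B f (c *\<^sub>C g) m = (c *\<^sub>C conv B f g) m"
    using conv_eq_sum_interval[OF B N order_refl order_refl]
      conv_eq_sum_interval[OF B N(1) vanishes_below_scale[OF N(2)] order_refl order_refl]
      clinear_scale[OF cbilinear_linear_right[OF B]]
    by (simp add: scaleC_sum_right)
qed

lemma clinear_conv_left:
  assumes "clinear X" "\<And>p. bounded_below (X p)" "bounded_below g"
  shows "clinear (\<lambda>p. conv B (X p) g)"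
  by (rule clinearI) (simp_all add: assms clinear_add clinear_scale conv_add_left conv_scale_left)

lemma clinear_conv_right:
  assumes "clinear X" "\<And>p. bounded_below (X p)" "bounded_below g"
  shows "clinear (\<lambda>p. conv B g (X p))"
  by (rule clinearI) (simp_all add: assms clinear_add clinear_scale conv_add_right conv_scale_right)

lemma conv_delta_left: "conv B (\<lambda>n. if n = 0 then c else 0) g = (\<lambda>m. B c (g m))"
proof
  fix m
  have "{p. (if p = 0 then c else 0) \<noteq> 0 \<and> g (m - p) \<noteq> 0} = (if c \<noteq> 0 \<and> g m \<noteq> 0 then {0} else {})"
    by auto
  then show "conv B (\<lambda>n. if n = 0 then c else 0) g m = B c (g m)"
    using cbilinear_zero_left[OF B] cbilinear_zero_right[OF B] by (auto simp: conv_def)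
qed

lemma conv_delta_right: "conv B f (\<lambda>n. if n = 0 then c else 0) = (\<lambda>m. B (f m) c)"
proof
  fix m
  have "{p. f p \<noteq> 0 \<and> (if m - p = 0 then c else 0) \<noteq> 0} = (if c \<noteq> 0 \<and> f m \<noteq> 0 then {m} else {})"
    by auto
  then show "conv B f (\<lambda>n. if n = 0 then c else 0) m = B (f m) c"
    using cbilinear_zero_left[OF B] cbilinear_zero_right[OF B] by (auto simp: conv_def)
qed

end

lemma exp_act_eq_sum_atMost:
  fixes D :: "'a::cvec \<Rightarrow> 'a"
  assumes D: "clinear D" and s: "vanishes_below N s" and K: "m - N \<le> int K"
  shows "exp_act D s m = (\<Sum>k\<le>K. (1 / fact k :: complex) *\<^sub>C (D ^^ k) (s (m - int k)))"
  unfolding exp_act_def of_nat_fact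
proof (rule sum.mono_neutral_left)
  show "{k. s (m - int k) \<noteq> 0} \<subseteq> {..K}"
    using vanishes_below_nonzeroD[OF s] K by fastforce
  show "\<forall>i\<in>{..K} - {k. s (m - int k) \<noteq> 0}. (1 / fact i :: complex) *\<^sub>C (D ^^ i) (s (m - int i)) = 0"
    using clinear_zero[OF clinear_funpow[OF D]] by auto
qed simp

lemma vanishes_below_exp_act:
  assumes "vanishes_below N s"
  shows "vanishes_below N (exp_act D s)"
proof -
  have "{k. s (m - int k) \<noteq> 0} = {}" if "m < N" for m
    using that assms vanishes_below_nonzeroD by fastforce
  then show ?thesis by (simp add: vanishes_below_def exp_act_def)
qed

lemma exp_act_zero: "exp_act D 0 = 0"
  by (simp add: exp_act_def fun_eq_iff)

lemma exp_act_add: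
  fixes D :: "'a::cvec \<Rightarrow> 'a"
  assumes D: "clinear D" and "bounded_below s" "bounded_below t"
  shows "exp_act D (s + t) = exp_act D s + exp_act D t"
proof
  fix m
  obtain N where N: "vanishes_below N s" "vanishes_below N t" using assms(2,3) by (rule bounded_below_common)
  have K: "m - N \<le> int (nat (m - N))" by simp
  show "exp_act D (s + t) m = (exp_act D s + exp_act D t) m"
    using exp_act_eq_sum_atMost[OF D N(1) K] exp_act_eq_sum_atMost[OF D N(2) K]
      exp_act_eq_sum_atMost[OF D vanishes_below_add[OF N] K]
      clinear_add[OF clinear_funpow[OF D]]
    by (simp add: sum.distrib scaleC_add_right)
qed

lemma exp_act_scale:
  fixes D :: "'a::cvec \<Rightarrow> 'a"
  assumes D: "clinear D" and "bounded_below s"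
  shows "exp_act D (c *\<^sub>C s) = c *\<^sub>C exp_act D s"
proof
  fix m
  obtain N where N: "vanishes_below N s" using assms by (auto simp: bounded_below_def)
  have K: "m - N \<le> int (nat (m - N))" by simp
  show "exp_act D (c *\<^sub>C s) m = (c *\<^sub>C exp_act D s) m"
    using exp_act_eq_sum_atMost[OF D N K] exp_act_eq_sum_atMost[OF D vanishes_below_scale[OF N] K]
      clinear_scale[OF clinear_funpow[OF D]]
    by (simp add: scaleC_sum_right scaleC_scaleC mult.commute)
qed

lemma clinear_exp_act:
  fixes D :: "'a::cvec \<Rightarrow> 'a"
  assumes "clinear D" "clinear X" "\<And>p. bounded_below (X p)"
  shows "clinear (\<lambda>p. exp_act D (X p))"
  by (rule clinearI) (simp_all add: assms clinear_add clinear_scale exp_act_add exp_act_scale)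

lemma exp_act_conv_scaleC:
  fixes D :: "'a::cvec \<Rightarrow> 'a"
  assumes D: "clinear D" and "bounded_below g" "bounded_below S"
  shows "exp_act D (conv (*\<^sub>C) g S) = conv (*\<^sub>C) g (exp_act D S)"
proof
  fix m
  obtain Ng Ns where g: "vanishes_below Ng g" and S: "vanishes_below Ns S"
    using assms(2,3) by (auto simp: bounded_below_def)
  define K where "K = nat (m - Ng - Ns)"
  define c :: "nat \<Rightarrow> complex" where "c k = 1 / fact k" for k
  have Dk: "clinear (D ^^ k)" for k using clinear_funpow[OF D] .
  have "exp_act D (conv (*\<^sub>C) g S) m = (\<Sum>k\<le>K. c k *\<^sub>C (D ^^ k) (conv (*\<^sub>C) g S (m - int k)))"
    using exp_act_eq_sum_atMost[OF D vanishes_below_conv[OF g S]] unfolding c_def K_def by simp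
  also have "\<dots> = (\<Sum>k\<le>K. c k *\<^sub>C (D ^^ k) (\<Sum>p\<in>{Ng..m - Ns}. g p *\<^sub>C S (m - int k - p)))"
    by (intro sum.cong refl arg_cong[where f="\<lambda>x. c _ *\<^sub>C (D ^^ _) x"]
        conv_eq_sum_interval[OF cbilinear_scaleC g S]) auto
  also have "\<dots> = (\<Sum>p\<in>{Ng..m - Ns}. \<Sum>k\<le>K. g p *\<^sub>C (c k *\<^sub>C (D ^^ k) (S (m - p - int k))))"
    by (subst sum.swap) (simp add: clinear_sum[OF Dk] clinear_scale[OF Dk] scaleC_sum_right
        scaleC_scaleC algebra_simps)
  also have "\<dots> = (\<Sum>p\<in>{Ng..m - Ns}. g p *\<^sub>C exp_act D S (m - p))"
  proof (intro sum.cong refl)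
    fix p assume "p \<in> {Ng..m - Ns}"
    then have "m - p - Ns \<le> int K" unfolding K_def by auto
    then show "(\<Sum>k\<le>K. g p *\<^sub>C (c k *\<^sub>C (D ^^ k) (S (m - p - int k)))) = g p *\<^sub>C exp_act D S (m - p)"
      using exp_act_eq_sum_atMost[OF D S, of "m - p" K] unfolding c_def by (simp add: scaleC_sum_right)
  qed
  also have "\<dots> = conv (*\<^sub>C) g (exp_act D S) m"
    using conv_eq_sum_interval[OF cbilinear_scaleC g vanishes_below_exp_act[OF S], of Ng m "m - Ns"] by simp
  finally show "exp_act D (conv (*\<^sub>C) g S) m = conv (*\<^sub>C) g (exp_act D S) m" .
qed

lemma tlift_exp_act:
  fixes G :: "'a::cvec \<Rightarrow> 'b::cvec \<Rightarrow> int \<Rightarrow> 'c::sep_cvec"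
  assumes G: "cbilinear G" and D: "clinear D" and bounded: "\<And>a b. bounded_below (G a b)"
  shows "bounded_below (tlift G t) \<and> tlift (\<lambda>a b. exp_act D (G a b)) t = exp_act D (tlift G t)"
proof -
  have expG: "cbilinear (\<lambda>a b. exp_act D (G a b))"
    using G bounded by (auto intro!: cbilinearI clinear_exp_act[OF D] dest: cbilinear_linear_left cbilinear_linear_right)
  show ?thesis
  proof (induction t rule: tensor_induct)
    case zero then show ?case
      unfolding clinear_zero[OF clinear_tlift[OF G]] clinear_zero[OF clinear_tlift[OF expG]] exp_act_zero
      using bounded_below_zero by blast
  next
    case (pure a b) then show ?case by (simp add: G expG bounded)
  next
    case (add x y) then show ?case
      unfolding clinear_add[OF clinear_tlift[OF G]] clinear_add[OF clinear_tlift[OF expG]]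
      using exp_act_add[OF D] bounded_below_add by metis
  next
    case (scale c x) then show ?case
      unfolding clinear_scale[OF clinear_tlift[OF G]] clinear_scale[OF clinear_tlift[OF expG]]
      using exp_act_scale[OF D] bounded_below_scale by metis
  qed
qed

section \<open>The creation property in a nonlocal vertex algebra\<close>

lemma Dop_eq_yser: "Dop Y one v = yser Y v one 1"
  by (simp add: yser_def Dop_def)

context
  fixes Y :: "'a::cvec \<Rightarrow> 'a \<Rightarrow> int \<Rightarrow> 'a" and one :: 'a
  assumes Y: "nlva Y one"
begin

lemma clinear_yser_left: "clinear (\<lambda>u. yser Y u v)"
  using cbilinear_linear_left[of Y v] Y by (auto simp: nlva_def clinear_def yser_def fun_eq_iff)

lemma clinear_yser_right: "clinear (yser Y u)"
  using cbilinear_linear_right[of Y u] Y by (auto simp: nlva_def clinear_def yser_def fun_eq_iff)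

lemma yser_zero_left: "yser Y 0 v = 0"
  using clinear_zero[OF clinear_yser_left] by blast

lemma yser_zero_right: "yser Y u 0 = 0"
  using clinear_zero[OF clinear_yser_right] by blast

lemma bounded_below_yser: "bounded_below (yser Y u v)"
proof -
  obtain N where "\<forall>n>N. Y u v n = 0" using Y unfolding nlva_def by blast
  then have "vanishes_below (- N - 1) (yser Y u v)"
    by (auto simp: vanishes_below_def yser_def)
  then show ?thesis by (auto simp: bounded_below_def)
qed

lemma yser_vacuum_left: "yser Y one v = (\<lambda>m. if m = 0 then v else 0)"
  using Y by (auto simp: nlva_def yser_def fun_eq_iff)

lemma vanishes_below_yser_vacuum: "vanishes_below 0 (yser Y v one)"
  using Y by (auto simp: nlva_def yser_def vanishes_below_def)

lemma yser_vacuum_0: "yser Y v one 0 = v"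
  using Y by (auto simp: nlva_def yser_def)

lemma clinear_Dop: "clinear (Dop Y one)"
proof -
  have "Dop Y one = (\<lambda>v. yser Y v one 1)" by (simp add: fun_eq_iff Dop_eq_yser)
  then show ?thesis using clinear_fun_apply[OF clinear_yser_left, of one 1] by simp
qed

end

lemma mult_binom_diff:
  "mult_binom k (\<lambda>a b. F a b - G a b) a b = mult_binom k F a b - mult_binom k G a b"
  by (simp add: mult_binom_def scaleC_diff_right sum_subtractf)

text \<open>Multiplication by \<open>(x0 + x2)^k\<close> is injective on series truncated below in \<open>x0\<close>:
  at the lowest \<open>x0\<close>-degree \<open>n0\<close> carrying a nonzero coefficient \<open>H n0 b0\<close>, the product
  has coefficient \<open>H n0 b0\<close> at \<open>x0^n0 x2^(b0+k)\<close>.\<close>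

lemma mult_binom_cancel:
  fixes H :: "int \<Rightarrow> int \<Rightarrow> 'a::cvec"
  assumes neg: "\<And>a b. a < 0 \<Longrightarrow> H a b = 0" and zero: "\<And>a b. mult_binom k H a b = 0"
  shows "H a b = 0"
proof (rule ccontr)
  assume "H a b \<noteq> 0"
  moreover have "0 \<le> a" using neg[of a b] \<open>H a b \<noteq> 0\<close> by force
  ultimately have ex: "\<exists>n::nat. \<exists>b. H (int n) b \<noteq> 0"
    by (intro exI[of _ "nat a"] exI[of _ b]) simp
  define n0 where "n0 = (LEAST n::nat. \<exists>b. H (int n) b \<noteq> 0)"
  obtain b0 where b0: "H (int n0) b0 \<noteq> 0"
    using LeastI_ex[OF ex] unfolding n0_def by blast
  have below: "H a' b' = 0" if "a' < int n0" for a' b'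
  proof (cases "a' < 0")
    case False
    then have "nat a' < n0" using that by auto
    then have "\<not> (\<exists>b. H (int (nat a')) b \<noteq> 0)" unfolding n0_def by (rule not_less_Least)
    then show ?thesis using False by auto
  qed (use neg in blast)
  have "mult_binom k H (int n0) (b0 + int k) =
      (\<Sum>t<k. of_nat (k choose t) *\<^sub>C H (int n0 - int (k - t)) (b0 + int k - int t)) + H (int n0) b0"
    unfolding mult_binom_def lessThan_Suc_atMost[symmetric] sum.lessThan_Suc by (simp add: scaleC_one)
  also have "\<dots> = H (int n0) b0"
    using below by (simp add: sum.neutral)
  finally show False using zero b0 by simp
qed

text \<open>Weak associativity for \<open>(u, 1, 1)\<close> gives \<open>Y(u, x0 + x2) 1 = Y(Y(u, x0) 1, x2) 1\<close>
  up to the factor \<open>(x0 + x2)^k\<close>, which cancels since both sides are regular in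
  \<open>x0\<close>; the coefficient of \<open>x0 x2^n\<close> is the recursion below.\<close>

lemma yser_vacuum_Suc:
  assumes Y: "nlva Y one"
  shows "of_nat (Suc n) *\<^sub>C yser Y u one (int n + 1) = yser Y (Dop Y one u) one (int n)"
proof -
  obtain k where k: "\<forall>a b. assoc_lhs Y k u one one a b = assoc_rhs Y k u one one a b"
    using Y unfolding nlva_def by blast
  define s where "s = yser Y u one"
  define F where "F = (\<lambda>i j. yser Y u (yser Y one one j) i)"
  define G where "G = (\<lambda>a b. yser Y (yser Y u one a) one b)"
  have F: "F i j = (if j = 0 then s i else 0)" for i j
    unfolding F_def s_def yser_vacuum_left[OF Y] using yser_zero_right[OF Y] by auto
  have subst_F: "subst_plus F a b =
      (if 0 \<le> b then (of_int (a + b) gchoose nat b) *\<^sub>C s (a + b) else 0)" for a b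
  proof -
    have "{l::nat. F (a + int l) (b - int l) \<noteq> 0} = (if 0 \<le> b \<and> s (a + b) \<noteq> 0 then {nat b} else {})"
      by (auto simp: F)
    then show ?thesis unfolding subst_plus_def by (auto simp: F)
  qed
  have s_neg: "s m = 0" if "m < 0" for m
    using vanishes_below_yser_vacuum[OF Y] that unfolding s_def vanishes_below_def by blast
  define H where "H = (\<lambda>a b. subst_plus F a b - G a b)"
  have "H a b = 0" if "a < 0" for a b
  proof -
    have "G a b = 0" unfolding G_def using s_neg[OF that] yser_zero_left[OF Y] unfolding s_def by simp
    moreover have "subst_plus F a b = 0"
    proof (cases "0 \<le> b \<and> 0 \<le> a + b")
      case True
      then have "(of_int (a + b) :: complex) gchoose nat b = of_nat (nat (a + b) choose nat b)"
        by (simp add: binomial_gbinomial)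
      also have "\<dots> = 0" using True that by (simp add: binomial_eq_0)
      finally show ?thesis using subst_F True by simp
    qed (use subst_F s_neg in auto)
    ultimately show ?thesis unfolding H_def by simp
  qed
  moreover have "mult_binom k H a b = 0" for a b
    using k unfolding H_def mult_binom_diff assoc_lhs_def assoc_rhs_def F_def G_def by simp
  ultimately have "H 1 (int n) = 0" by (rule mult_binom_cancel)
  moreover have "(of_int (1 + int n) :: complex) gchoose n = of_nat (Suc n)"
    by (metis binomial_Suc_n binomial_gbinomial of_int_of_nat_eq of_nat_Suc)
  ultimately have "of_nat (Suc n) *\<^sub>C s (int n + 1) = G 1 (int n)"
    unfolding H_def subst_F by (simp add: add.commute)
  then show ?thesis unfolding s_def G_def Dop_eq_yser .
qed

lemma yser_vacuum:
  assumes Y: "nlva Y one"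
  shows "yser Y u one (int n) = (1 / fact n :: complex) *\<^sub>C (Dop Y one ^^ n) u"
proof (induction n arbitrary: u)
  case 0 then show ?case using yser_vacuum_0[OF Y] by (simp add: scaleC_one)
next
  case (Suc n)
  have "1 + (of_nat n :: complex) \<noteq> 0" by (metis of_nat_Suc of_nat_neq_0)
  then have "yser Y u one (int (Suc n)) =
      (1 / of_nat (Suc n) :: complex) *\<^sub>C (of_nat (Suc n) *\<^sub>C yser Y u one (int n + 1))"
    by (simp add: scaleC_scaleC scaleC_one add.commute)
  also have "\<dots> = (1 / of_nat (Suc n) :: complex) *\<^sub>C yser Y (Dop Y one u) one (int n)"
    using yser_vacuum_Suc[OF Y] by simp
  also have "\<dots> = (1 / fact (Suc n) :: complex) *\<^sub>C (Dop Y one ^^ Suc n) u"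
    using Suc[of "Dop Y one u"] by (simp add: scaleC_scaleC funpow_Suc_right del: funpow.simps)
  finally show ?case .
qed

section \<open>Commuting operators\<close>

lemma funpow_commute:
  assumes "\<And>x. P (Q x) = Q (P x)"
  shows "P ((Q ^^ n) x) = (Q ^^ n) (P x)"
  by (induction n) (simp_all add: assms)

lemma sum_atMost_Suc_binomial:
  fixes T :: "nat \<Rightarrow> 'a::cvec"
  shows "(\<Sum>k\<le>Suc n. of_nat (Suc n choose k) *\<^sub>C T k) =
    (\<Sum>k\<le>n. of_nat (n choose k) *\<^sub>C T (Suc k)) + (\<Sum>k\<le>n. of_nat (n choose k) *\<^sub>C T k)"
proof -
  have "(\<Sum>k\<le>n. of_nat (n choose k) *\<^sub>C T k) = (\<Sum>k\<le>Suc n. of_nat (n choose k) *\<^sub>C T k)"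
    by (simp add: binomial_eq_0)
  also have "\<dots> = T 0 + (\<Sum>k\<le>n. of_nat (n choose Suc k) *\<^sub>C T (Suc k))"
    by (subst sum.atMost_Suc_shift) (simp add: scaleC_one)
  finally have shift: "(\<Sum>k\<le>n. of_nat (n choose k) *\<^sub>C T k) =
      T 0 + (\<Sum>k\<le>n. of_nat (n choose Suc k) *\<^sub>C T (Suc k))" .
  have "(\<Sum>k\<le>Suc n. of_nat (Suc n choose k) *\<^sub>C T k) =
      T 0 + ((\<Sum>k\<le>n. of_nat (n choose k) *\<^sub>C T (Suc k)) +
      (\<Sum>k\<le>n. of_nat (n choose Suc k) *\<^sub>C T (Suc k)))"
    by (subst sum.atMost_Suc_shift) (simp add: scaleC_one scaleC_add_left sum.distrib)
  then show ?thesis unfolding shift by (simp add: add_ac)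
qed

lemma funpow_add_commuting:
  fixes P Q :: "'a::cvec \<Rightarrow> 'a"
  assumes P: "clinear P" and Q: "clinear Q" and PQ: "\<And>x. P (Q x) = Q (P x)"
  shows "((\<lambda>x. P x + Q x) ^^ n) x = (\<Sum>k\<le>n. of_nat (n choose k) *\<^sub>C (P ^^ k) ((Q ^^ (n - k)) x))"
proof (induction n)
  case 0 then show ?case by (simp add: scaleC_one)
next
  case (Suc n)
  have QP: "Q ((P ^^ k) y) = (P ^^ k) (Q y)" for k y
    by (rule funpow_commute) (rule PQ[symmetric])
  have "((\<lambda>x. P x + Q x) ^^ Suc n) x =
      (\<Sum>k\<le>n. of_nat (n choose k) *\<^sub>C (P ^^ Suc k) ((Q ^^ (n - k)) x)) +
      (\<Sum>k\<le>n. of_nat (n choose k) *\<^sub>C (P ^^ k) ((Q ^^ (Suc n - k)) x))"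
    unfolding funpow.simps(2) o_apply Suc clinear_sum[OF P] clinear_sum[OF Q]
      clinear_scale[OF P] clinear_scale[OF Q] QP
    by (simp add: Suc_diff_le)
  also have "\<dots> = (\<Sum>k\<le>Suc n. of_nat (Suc n choose k) *\<^sub>C (P ^^ k) ((Q ^^ (Suc n - k)) x))"
    unfolding sum_atMost_Suc_binomial[of n "\<lambda>k. (P ^^ k) ((Q ^^ (Suc n - k)) x)"] by simp
  finally show ?case .
qed

text \<open>The coefficientwise form of \<open>e^{xP} e^{xQ} = e^{x(P + Q)}\<close>.\<close>

lemma exp_coeff_add_commuting:
  fixes P Q :: "'a::cvec \<Rightarrow> 'a"
  assumes P: "clinear P" and Q: "clinear Q" and PQ: "\<And>x. P (Q x) = Q (P x)"
  shows "(\<Sum>k\<le>n. (1 / fact k :: complex) *\<^sub>C (P ^^ k) ((1 / fact (n - k) :: complex) *\<^sub>C (Q ^^ (n - k)) x))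
    = (1 / fact n :: complex) *\<^sub>C ((\<lambda>x. P x + Q x) ^^ n) x"
proof -
  have coeff: "1 / (fact k * fact (n - k) :: complex) = of_nat (n choose k) / fact n"
    if "k \<le> n" for k
    using binomial_fact[OF that, where 'a=complex] by (simp add: field_simps)
  have "(\<Sum>k\<le>n. (1 / fact k :: complex) *\<^sub>C (P ^^ k) ((1 / fact (n - k) :: complex) *\<^sub>C (Q ^^ (n - k)) x))
      = (\<Sum>k\<le>n. (1 / fact n * of_nat (n choose k) :: complex) *\<^sub>C (P ^^ k) ((Q ^^ (n - k)) x))"
    by (intro sum.cong refl) (simp add: clinear_scale[OF clinear_funpow[OF P]] scaleC_scaleC coeff)
  also have "\<dots> = (1 / fact n :: complex) *\<^sub>C (\<Sum>k\<le>n. of_nat (n choose k) *\<^sub>C (P ^^ k) ((Q ^^ (n - k)) x))"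
    by (simp add: scaleC_sum_right scaleC_scaleC)
  also have "\<dots> = (1 / fact n :: complex) *\<^sub>C ((\<lambda>x. P x + Q x) ^^ n) x"
    unfolding funpow_add_commuting[of P Q, OF assms] ..
  finally show ?thesis .
qed

lemma funpow_scaleC:
  fixes P :: "'a::cvec \<Rightarrow> 'a"
  assumes "clinear P"
  shows "((\<lambda>x. c *\<^sub>C P x) ^^ n) x = (c ^ n) *\<^sub>C (P ^^ n) x"
  by (induction n) (simp_all add: scaleC_one clinear_scale[OF assms] scaleC_scaleC mult.commute)

section \<open>The twisted tensor product\<close>

text \<open>\<open>YR_term Yu Yv f u a b v'\<close> is the series \<open>f(-x) Y(u, x)a \<otimes> Y(b, x)v'\<close>, the
  contribution of a summand \<open>a \<otimes> b \<otimes> f\<close> of \<open>R(x)(v \<otimes> u')\<close> to \<open>Y_R(u \<otimes> v, x)(u' \<otimes> v')\<close>.\<close>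

definition YR_term :: "('u::cvec \<Rightarrow> 'u \<Rightarrow> int \<Rightarrow> 'u) \<Rightarrow> ('v::cvec \<Rightarrow> 'v \<Rightarrow> int \<Rightarrow> 'v)
    \<Rightarrow> laurent \<Rightarrow> 'u \<Rightarrow> 'u \<Rightarrow> 'v \<Rightarrow> 'v \<Rightarrow> int \<Rightarrow> ('u, 'v) tensor" where
  "YR_term Yu Yv f u a b v' = conv (*\<^sub>C) (negser (lcoeff f)) (conv (\<otimes>) (yser Yu u a) (yser Yv b v'))"

definition YR_term_sum :: "('u::cvec \<Rightarrow> 'u \<Rightarrow> int \<Rightarrow> 'u) \<Rightarrow> ('v::cvec \<Rightarrow> 'v \<Rightarrow> int \<Rightarrow> 'v)
    \<Rightarrow> 'u \<Rightarrow> 'v \<Rightarrow> ('u, 'v) tensor \<Rightarrow> laurent \<Rightarrow> int \<Rightarrow> ('u, 'v) tensor" where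
  "YR_term_sum Yu Yv u v' t f = tlift (\<lambda>a b. YR_term Yu Yv f u a b v') t"

lemma YR_simple_eq: "YR_simple Yu Yv R u v u' v' = tlift (YR_term_sum Yu Yv u v') (R (v \<otimes> u'))"
  unfolding YR_simple_def YR_term_sum_def YR_term_def ..

text \<open>The summand \<open>f(-x) Y(a, -x)1 \<otimes> b\<close> of the right-hand side of skew symmetry.\<close>

definition YR_skew_term :: "('u::cvec \<Rightarrow> 'u \<Rightarrow> int \<Rightarrow> 'u) \<Rightarrow> 'u \<Rightarrow> laurent \<Rightarrow> 'u \<Rightarrow> 'v::cvec
    \<Rightarrow> int \<Rightarrow> ('u, 'v) tensor" where
  "YR_skew_term Yu oneu f a b = conv (*\<^sub>C) (negser (lcoeff f)) (negser (\<lambda>m. yser Yu a oneu m \<otimes> b))"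

context
  fixes Yu :: "'u::cvec \<Rightarrow> 'u \<Rightarrow> int \<Rightarrow> 'u" and oneu :: 'u
    and Yv :: "'v::cvec \<Rightarrow> 'v \<Rightarrow> int \<Rightarrow> 'v" and onev :: 'v
    and R :: "('u, 'v) twop"
  assumes U: "nlva Yu oneu" and V: "nlva Yv onev"
    and R: "twisting_operator Yu oneu Yv onev R"
begin

lemma clinear_R: "clinear R"
  using R by (simp add: twisting_operator_def)

lemma R_vacuum_right: "R (v \<otimes> oneu) = (oneu \<otimes> v) \<otimes> lone"
  using R by (simp add: twisting_operator_def)

lemmas bounded_below_intros =
  bounded_below_conv bounded_below_negser bounded_below_lcoeff bounded_below_tensor_left
  bounded_below_yser[OF U] bounded_below_yser[OF V]

lemma clinear_negser_lcoeff: "clinear (\<lambda>f. negser (lcoeff f))"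
  by (rule clinear_comp[OF clinear_negser clinear_lcoeff])

lemma clinear_YR_term_laurent: "clinear (\<lambda>f. YR_term Yu Yv f u a b v')"
  unfolding YR_term_def
  by (intro clinear_conv_left[OF cbilinear_scaleC] clinear_negser_lcoeff bounded_below_intros)

lemma clinear_YR_term_u: "clinear (\<lambda>u. YR_term Yu Yv f u a b v')"
  unfolding YR_term_def
  by (intro clinear_conv_right[OF cbilinear_scaleC] clinear_conv_left[OF cbilinear_tensor]
      clinear_yser_left[OF U] bounded_below_intros)

lemma clinear_YR_term_a: "clinear (\<lambda>a. YR_term Yu Yv f u a b v')"
  unfolding YR_term_def
  by (intro clinear_conv_right[OF cbilinear_scaleC] clinear_conv_left[OF cbilinear_tensor]
      clinear_yser_right[OF U] bounded_below_intros)

lemma clinear_YR_term_b: "clinear (\<lambda>b. YR_term Yu Yv f u a b v')"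
  unfolding YR_term_def
  by (intro clinear_conv_right[OF cbilinear_scaleC] clinear_conv_right[OF cbilinear_tensor]
      clinear_yser_left[OF V] bounded_below_intros)

lemma clinear_YR_term_v': "clinear (\<lambda>v'. YR_term Yu Yv f u a b v')"
  unfolding YR_term_def
  by (intro clinear_conv_right[OF cbilinear_scaleC] clinear_conv_right[OF cbilinear_tensor]
      clinear_yser_right[OF V] bounded_below_intros)

lemma cbilinear_YR_term: "cbilinear (\<lambda>a b. YR_term Yu Yv f u a b v')"
  by (intro cbilinearI clinear_YR_term_a clinear_YR_term_b)

lemma cbilinear_YR_term_sum: "cbilinear (YR_term_sum Yu Yv u v')"
  unfolding YR_term_sum_def[abs_def]
  by (rule cbilinear_tlift_param[where G="\<lambda>f a b. YR_term Yu Yv f u a b v'"])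
    (intro cbilinear_YR_term clinear_YR_term_laurent)+

lemma clinear_YR_term_sum_u: "clinear (\<lambda>u. YR_term_sum Yu Yv u v' t f)"
  unfolding YR_term_sum_def
  by (rule clinear_tlift_param[where G="\<lambda>u a b. YR_term Yu Yv f u a b v'"])
    (intro cbilinear_YR_term clinear_YR_term_u)+

lemma clinear_YR_term_sum_v': "clinear (\<lambda>v'. YR_term_sum Yu Yv u v' t f)"
  unfolding YR_term_sum_def
  by (rule clinear_tlift_param[where G="\<lambda>v' a b. YR_term Yu Yv f u a b v'"])
    (intro cbilinear_YR_term clinear_YR_term_v')+

lemma cbilinear_YR_simple: "cbilinear (YR_simple Yu Yv R u v)"
proof (rule cbilinearI)
  show "clinear (\<lambda>u'. YR_simple Yu Yv R u v u' v')" for v'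
    unfolding YR_simple_eq
    by (intro clinear_comp[OF clinear_tlift[OF cbilinear_YR_term_sum]] clinear_comp[OF clinear_R]
        cbilinear_linear_right[OF cbilinear_tensor])
  show "clinear (YR_simple Yu Yv R u v u')" for u'
    unfolding YR_simple_eq
    by (rule clinear_tlift_param[where G="\<lambda>v'. YR_term_sum Yu Yv u v'"])
      (intro cbilinear_YR_term_sum clinear_YR_term_sum_v')+
qed

lemma cbilinear_tlift_YR_simple: "cbilinear (\<lambda>u v. tlift (YR_simple Yu Yv R u v))"
proof (rule cbilinear_tlift_bilinear_param)
  show "clinear (\<lambda>u. YR_simple Yu Yv R u v u' v')" for v u' v'
    unfolding YR_simple_eq
    by (rule clinear_tlift_param[where G="\<lambda>u. YR_term_sum Yu Yv u v'"])
      (intro cbilinear_YR_term_sum clinear_YR_term_sum_u)+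
  show "clinear (\<lambda>v. YR_simple Yu Yv R u v u' v')" for u u' v'
    unfolding YR_simple_eq
    by (intro clinear_comp[OF clinear_tlift[OF cbilinear_YR_term_sum]] clinear_comp[OF clinear_R]
        cbilinear_linear_left[OF cbilinear_tensor])
qed (rule cbilinear_YR_simple)

lemma yser_YR: "yser (YR Yu Yv R) w w' = tlift (\<lambda>u v. tlift (YR_simple Yu Yv R u v)) w w'"
  by (simp add: yser_def YR_def YRser_def fun_eq_iff)

lemma yser_YR_tensor: "yser (YR Yu Yv R) (u \<otimes> v) (u' \<otimes> v') = YR_simple Yu Yv R u v u' v'"
  unfolding yser_YR by (simp add: cbilinear_tlift_YR_simple cbilinear_YR_simple)

lemma clinear_yser_YR_left: "clinear (\<lambda>w. yser (YR Yu Yv R) w w' m)"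
  unfolding yser_YR
  by (intro clinear_fun_apply[of "\<lambda>w. tlift _ w w'"] clinear_fun_apply[of "tlift _"]
      clinear_tlift cbilinear_tlift_YR_simple)

lemma yser_YR_vacuum_right:
  "yser (YR Yu Yv R) (u \<otimes> v) (oneu \<otimes> v') = conv (\<otimes>) (yser Yu u oneu) (yser Yv v v')"
  unfolding yser_YR_tensor YR_simple_eq R_vacuum_right tlift_tensor[OF cbilinear_YR_term_sum]
    YR_term_sum_def tlift_tensor[OF cbilinear_YR_term]
  by (simp add: YR_term_def lone.rep_eq negser_delta conv_delta_left[OF cbilinear_scaleC] scaleC_one)

lemma yser_YR_u_v: "yser (YR Yu Yv R) (u \<otimes> onev) (oneu \<otimes> v) = (\<lambda>m. yser Yu u oneu m \<otimes> v)"
  unfolding yser_YR_vacuum_right yser_vacuum_left[OF V] conv_delta_right[OF cbilinear_tensor] ..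

abbreviation "D_left \<equiv> tmap (Dop Yu oneu) (id :: 'v \<Rightarrow> 'v)"
abbreviation "D_right \<equiv> tmap (id :: 'u \<Rightarrow> 'u) (Dop Yv onev)"

lemma clinear_D_left: "clinear D_left"
  by (rule clinear_tmap[OF clinear_Dop[OF U] clinear_id])

lemma clinear_D_right: "clinear D_right"
  by (rule clinear_tmap[OF clinear_id clinear_Dop[OF V]])

lemma D_left_tensor: "D_left (a \<otimes> b) = Dop Yu oneu a \<otimes> b"
  by (simp add: tmap_tensor[OF clinear_Dop[OF U] clinear_id])

lemma D_right_tensor: "D_right (a \<otimes> b) = a \<otimes> Dop Yv onev b"
  by (simp add: tmap_tensor[OF clinear_id clinear_Dop[OF V]])

lemma Dop_YR: "Dop (YR Yu Yv R) (oneu \<otimes> onev) t = D_left t + D_right t"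
proof (rule tensor_linear_eqI[of "\<lambda>t. Dop (YR Yu Yv R) (oneu \<otimes> onev) t"])
  show "clinear (Dop (YR Yu Yv R) (oneu \<otimes> onev))"
    using clinear_yser_YR_left by (simp add: Dop_eq_yser[abs_def])
  show "clinear (\<lambda>t. D_left t + D_right t)"
    by (rule clinear_plus[OF clinear_D_left clinear_D_right])
next
  fix a b
  have "Dop (YR Yu Yv R) (oneu \<otimes> onev) (a \<otimes> b) = conv (\<otimes>) (yser Yu a oneu) (yser Yv b onev) 1"
    unfolding Dop_eq_yser yser_YR_vacuum_right ..
  also have "\<dots> = (\<Sum>p\<in>{0..1}. yser Yu a oneu p \<otimes> yser Yv b onev (1 - p))"
    by (rule conv_eq_sum_interval[OF cbilinear_tensor vanishes_below_yser_vacuum[OF U]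
          vanishes_below_yser_vacuum[OF V]]) auto
  also have "\<dots> = D_left (a \<otimes> b) + D_right (a \<otimes> b)"
  proof -
    have "{0..1::int} = {0, 1}" by auto
    then show ?thesis by (simp add: D_left_tensor D_right_tensor yser_vacuum_0[OF U] yser_vacuum_0[OF V]
        Dop_eq_yser add.commute)
  qed
  finally show "Dop (YR Yu Yv R) (oneu \<otimes> onev) (a \<otimes> b) = D_left (a \<otimes> b) + D_right (a \<otimes> b)" .
qed

lemma D_left_D_right_commute: "D_left (D_right x) = D_right (D_left x)"
proof (rule tensor_linear_eqI[of "\<lambda>x. D_left (D_right x)"])
  show "clinear (\<lambda>x. D_left (D_right x))" "clinear (\<lambda>x. D_right (D_left x))"
    by (rule clinear_comp[OF clinear_D_left clinear_D_right], rule clinear_comp[OF clinear_D_right clinear_D_left])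
  show "D_left (D_right (a \<otimes> b)) = D_right (D_left (a \<otimes> b))" for a b
    unfolding D_left_tensor D_right_tensor ..
qed

lemma exp_act_D_creation_skew:
  "exp_act (\<lambda>t. D_left t + D_right t) (negser (\<lambda>m. yser Yu a oneu m \<otimes> b)) = (\<lambda>m. a \<otimes> yser Yv b onev m)"
proof
  fix m
  define S where "S = negser (\<lambda>m. yser Yu a oneu m \<otimes> b)"
  define D where "D = (\<lambda>t. D_left t + D_right t)"
  define Q where "Q = (\<lambda>t. (-1::complex) *\<^sub>C D_left t)"
  have D: "clinear D" unfolding D_def by (rule clinear_plus[OF clinear_D_left clinear_D_right])
  have Q: "clinear Q" unfolding Q_def by (rule clinear_scaleC[OF clinear_D_left])
  have DQ: "D (Q x) = Q (D x)" for x
    unfolding D_def Q_def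
    by (simp add: clinear_scale[OF clinear_D_left] clinear_scale[OF clinear_D_right] clinear_add[OF clinear_D_left]
        D_left_D_right_commute scaleC_add_right)
  have D_plus_Q: "(\<lambda>x. D x + Q x) = D_right"
    unfolding D_def Q_def scaleC_minus1_left by simp
  have S_vanishes: "vanishes_below 0 S"
    unfolding S_def using vanishes_below_yser_vacuum[OF U]
    by (intro vanishes_below_negser) (auto simp: vanishes_below_def)
  have S_nat: "S (int j) = (1 / fact j :: complex) *\<^sub>C (Q ^^ j) (a \<otimes> b)" for j
    unfolding S_def Q_def negser_nat yser_vacuum[OF U] tensor_scale_left
      funpow_scaleC[OF clinear_D_left] tmap_funpow_tensor[OF clinear_Dop[OF U] clinear_id]
    by (simp add: scaleC_scaleC mult.commute)
  show "exp_act D S m = a \<otimes> yser Yv b onev m"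
  proof (cases "m < 0")
    case True
    then show ?thesis
      using vanishes_below_exp_act[OF S_vanishes, of D] vanishes_below_yser_vacuum[OF V]
        cbilinear_zero_right[OF cbilinear_tensor]
      by (simp add: vanishes_below_def)
  next
    case False
    then obtain n where m: "m = int n" by (metis nonneg_int_cases not_less)
    have "exp_act D S (int n) = (\<Sum>k\<le>n. (1 / fact k :: complex) *\<^sub>C (D ^^ k) (S (int n - int k)))"
      by (rule exp_act_eq_sum_atMost[OF D S_vanishes]) simp
    also have "\<dots> = (\<Sum>k\<le>n. (1 / fact k :: complex) *\<^sub>C
        (D ^^ k) ((1 / fact (n - k) :: complex) *\<^sub>C (Q ^^ (n - k)) (a \<otimes> b)))"
      by (intro sum.cong refl) (simp add: S_nat[symmetric] of_nat_diff)
    also have "\<dots> = (1 / fact n :: complex) *\<^sub>C (D_right ^^ n) (a \<otimes> b)"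
      unfolding exp_coeff_add_commuting[of D Q, OF D Q DQ] D_plus_Q ..
    also have "\<dots> = a \<otimes> yser Yv b onev (int n)"
      by (simp add: yser_vacuum[OF V] tensor_scale_right tmap_funpow_tensor[OF clinear_id clinear_Dop[OF V]])
    finally show ?thesis unfolding m .
  qed
qed

lemma YR_term_vacuum_skew:
  "YR_term Yu Yv f oneu a b onev = exp_act (\<lambda>t. D_left t + D_right t) (YR_skew_term Yu oneu f a b)"
proof -
  have "YR_term Yu Yv f oneu a b onev = conv (*\<^sub>C) (negser (lcoeff f)) (\<lambda>m. a \<otimes> yser Yv b onev m)"
    unfolding YR_term_def yser_vacuum_left[OF U] conv_delta_left[OF cbilinear_tensor] ..
  also have "\<dots> = conv (*\<^sub>C) (negser (lcoeff f))
      (exp_act (\<lambda>t. D_left t + D_right t) (negser (\<lambda>m. yser Yu a oneu m \<otimes> b)))"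
    unfolding exp_act_D_creation_skew ..
  also have "\<dots> = exp_act (\<lambda>t. D_left t + D_right t) (YR_skew_term Yu oneu f a b)"
    unfolding YR_skew_term_def
    by (rule exp_act_conv_scaleC[symmetric])
      (intro clinear_plus clinear_D_left clinear_D_right bounded_below_intros)+
  finally show ?thesis .
qed

lemma bounded_below_YR_skew_term: "bounded_below (YR_skew_term Yu oneu f a b)"
  unfolding YR_skew_term_def by (intro bounded_below_intros)

lemma cbilinear_YR_skew_term: "cbilinear (YR_skew_term Yu oneu f)"
proof (rule cbilinearI)
  show "clinear (\<lambda>a. YR_skew_term Yu oneu f a b)" for b
    unfolding YR_skew_term_def
    by (intro clinear_conv_right[OF cbilinear_scaleC] clinear_comp[OF clinear_negser]
        bounded_below_intros clinearI)
      (simp_all add: fun_eq_iff clinear_add[OF clinear_yser_left[OF U]]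
        clinear_scale[OF clinear_yser_left[OF U]] tensor_add_left tensor_scale_left)
  show "clinear (YR_skew_term Yu oneu f a)" for a
    unfolding YR_skew_term_def
    by (intro clinear_conv_right[OF cbilinear_scaleC] clinear_comp[OF clinear_negser]
        bounded_below_intros clinearI)
      (simp_all add: fun_eq_iff tensor_add_right tensor_scale_right)
qed

lemma clinear_YR_skew_term_laurent: "clinear (\<lambda>f. YR_skew_term Yu oneu f a b)"
  unfolding YR_skew_term_def
  by (intro clinear_conv_left[OF cbilinear_scaleC] clinear_negser_lcoeff bounded_below_intros)

lemma YR_skew_symmetry:
  "yser (YR Yu Yv R) (oneu \<otimes> v) (u \<otimes> onev)
    = exp_act (Dop (YR Yu Yv R) (oneu \<otimes> onev))
        (tlift (\<lambda>t f. tlift (\<lambda>a b.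
           conv (*\<^sub>C) (negser (lcoeff f))
             (negser (yser (YR Yu Yv R) (a \<otimes> onev) (oneu \<otimes> b)))) t)
          (R (v \<otimes> u)))"
proof -
  let ?D = "\<lambda>t. D_left t + D_right t"
  let ?K = "\<lambda>t f. tlift (YR_skew_term Yu oneu f) t"
  have D: "clinear ?D" by (rule clinear_plus[OF clinear_D_left clinear_D_right])
  have K: "cbilinear ?K"
    by (rule cbilinear_tlift_param) (intro cbilinear_YR_skew_term clinear_YR_skew_term_laurent)+
  have inner: "tlift (\<lambda>a b. YR_term Yu Yv f oneu a b onev) t = exp_act ?D (?K t f)"
    "bounded_below (?K t f)" for t f
    using tlift_exp_act[OF cbilinear_YR_skew_term[of f] D bounded_below_YR_skew_term, of t]
    unfolding YR_term_vacuum_skew by auto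
  have "yser (YR Yu Yv R) (oneu \<otimes> v) (u \<otimes> onev) = tlift (\<lambda>t f. exp_act ?D (?K t f)) (R (v \<otimes> u))"
    unfolding yser_YR_tensor YR_simple_eq YR_term_sum_def[abs_def] inner(1) ..
  also have "\<dots> = exp_act ?D (tlift ?K (R (v \<otimes> u)))"
    using tlift_exp_act[OF K D inner(2)] by blast
  finally show ?thesis
    unfolding Dop_YR[abs_def] yser_YR_u_v YR_skew_term_def .
qed

end

theorem proposition2p5:
  fixes Yu :: "'u::cvec \<Rightarrow> 'u \<Rightarrow> int \<Rightarrow> 'u" and oneu :: 'u
    and Yv :: "'v::cvec \<Rightarrow> 'v \<Rightarrow> int \<Rightarrow> 'v" and onev :: 'v
    and R :: "('u, 'v) twop"
  assumes "nlva Yu oneu" and "nlva Yv onev"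
    and "twisting_operator Yu oneu Yv onev R"
  shows "(\<forall>t. Dop (YR Yu Yv R) (oneu \<otimes> onev) t
              = tmap (Dop Yu oneu) id t + tmap id (Dop Yv onev) t)
    \<and> (\<forall>u v m. m < 0 \<longrightarrow> yser (YR Yu Yv R) (u \<otimes> onev) (oneu \<otimes> v) m = 0)
    \<and> (\<forall>u v. yser (YR Yu Yv R) (oneu \<otimes> v) (u \<otimes> onev)
           = exp_act (Dop (YR Yu Yv R) (oneu \<otimes> onev))
               (tlift (\<lambda>t f. tlift (\<lambda>a b.
                  conv (*\<^sub>C) (negser (lcoeff f))
                    (negser (yser (YR Yu Yv R) (a \<otimes> onev) (oneu \<otimes> b)))) t)
                 (R (v \<otimes> u))))"
  using Dop_YR[OF assms] yser_YR_u_v[OF assms] vanishes_below_yser_vacuum[OF assms(1)]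
    YR_skew_symmetry[OF assms]
  by (auto simp: vanishes_below_def)

end
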